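(* (i) Let $I=[0,\gamma)$ with $0<\gamma\le\infty$, let $\varphi$ be a nondegenerate Orlicz function and let $w$ be a weight function on $I$. If $\varphi$ does not satisfy the appropriate $\Delta_2$-condition (the $\Delta_2^\infty$-condition if $\gamma<\infty$, the $\Delta_2$-condition if $\gamma=\infty$), then $(\Lambda_{\varphi,w})_a$ and $\Lambda_{\varphi,w}$ have the strong diameter two property. Hence $(\Lambda_{\varphi,w})_a$ and $\Lambda_{\varphi,w}$ have the diameter two property and the local diameter two property. (ii) Let $\varphi$ be a nondegenerate Orlicz function and let $w$ be a weight sequence. If $\varphi$ does not satisfy the $\Delta_2^0$-condition, then $(\lambda_{\varphi,w})_a$ and $\lambda_{\varphi,w}$ have the strong diameter two property. Hence $(\lambda_{\varphi,w})_a$ and $\lambda_{\varphi,w}$ have the diameter two property and the local diameter two property. All spaces carry the Luxemburg norm.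
   Context: All Banach spaces are real. A slice of the unit ball $B_X$ is $S(x^*,\epsilon)=\{x\in B_X:x^*x>1-\epsilon\}$ with $x^*\in S_{X^*}$, $\epsilon>0$. $X$ has the local diameter two property (LD2P) if every slice of $B_X$ has diameter two; the diameter two property (D2P) if every nonempty relatively weakly open subset of $B_X$ has diameter two; the strong diameter two property (SD2P) if every convex combination of slices of $B_X$ has diameter two. An Orlicz function is a convex function $\varphi:[0,\infty)\to[0,\infty)$ with $\varphi(0)=0$, not identically zero; it is nondegenerate if $\varphi(u)>0$ for all $u>0$. $\varphi$ satisfies the $\Delta_2^0$-condition if there are $K>2$, $u_0>0$ with $\varphi(2u)\le K\varphi(u)$ for all $u\le u_0$; the $\Delta_2^\infty$-condition if there are $K>2$, $u_0\ge 0$ with $\varphi(2u)\le K\varphi(u)$ for all $u\ge u_0$; the $\Delta_2$-condition if it satisfies both. A weight function is a decreasing (i.e. non-increasing), positive, locally integrable function $w$ on $I=[0,\gamma)$ with $\int_0^t w<\infty$ for $t\in[0,\gamma)$; if $\gamma=\infty$ it is assumed that $\int_0^\infty w=\infty$. For measurable $f$ on $I$ (Lebesgue measure $m$), $d_f(\lambda)=m\{t:|f(t)|>\lambda\}$, $f^*(t)=\inf\{\lambda>0:d_f(\lambda)\le t\}$, $\rho_{\varphi,w}(f)=\int_I\varphi(f^* )w$; $\Lambda_{\varphi,w}=\{f:\rho_{\varphi,w}(kf)<\infty\text{ for some }k>0\}$ with Luxemburg norm $\|f\|_{\varphi,w}=\inf\{\epsilon>0:\rho_{\varphi,w}(f/\epsilon)\le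 1\}$. A weight sequence is a decreasing sequence $w=(w(i))$ of positive reals with $\sum_i w(i)=\infty$. For a real sequence $x$, $d_x(\lambda)$ is the number of $i$ with $|x(i)|>\lambda$, $x^*(i)=\inf\{\lambda>0:d_x(\lambda)<i\}$, $\alpha_{\varphi,w}(x)=\sum_i\varphi(x^*(i))w(i)$; $\lambda_{\varphi,w}=\{x:\alpha_{\varphi,w}(kx)<\infty\text{ for some }k>0\}$ with Luxemburg norm $\|x\|_{\varphi,w}=\inf\{\epsilon>0:\alpha_{\varphi,w}(x/\epsilon)\le 1\}$. For a Banach function or sequence lattice $X$, $X_a$ is the closed subspace of order-continuous elements: $f\in X$ such that $\|f_n\|_X\downarrow 0$ for every sequence with $0\le f_n\le|f|$ and $f_n\downarrow 0$ a.e. *)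

theory Defs
  imports "HOL-Analysis.Analysis"
begin

section \<open>Diameter two properties of normed function spaces\<close>

text \<open>
  A normed space is given by a set \<open>X\<close> of real functions, closed under the pointwise
  vector operations, and a seminorm \<open>N\<close> on it. The Banach space meant is the
  quotient of \<open>X\<close> by the functions with \<open>N f = 0\<close>, which in the function spaces
  below are the functions vanishing almost everywhere. Functionals bounded with respect to \<open>N\<close>
  are constant on the classes, so that balls, slices, weakly open sets and diameters are
  computed on representatives. Functionals are only relevant on \<open>X\<close>.
\<close>

definition bounded_functional ::
    "('a \<Rightarrow> real) set \<Rightarrow> (('a \<Rightarrow> real) \<Rightarrow> real) \<Rightarrow> (('a \<Rightarrow> real) \<Rightarrow> real) \<Rightarrow> bool" where
  "bounded_functional X N L \<longleftrightarrow>
     (\<forall>f\<in>X. \<forall>g\<in>X. L (\<lambda>t. f t + g t) = L f + L g) \<and>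
     (\<forall>c. \<forall>f\<in>X. L (\<lambda>t. c * f t) = c * L f) \<and>
     (\<exists>C. \<forall>f\<in>X. \<bar>L f\<bar> \<le> C * N f)"

definition unit_ball :: "('a \<Rightarrow> real) set \<Rightarrow> (('a \<Rightarrow> real) \<Rightarrow> real) \<Rightarrow> ('a \<Rightarrow> real) set" where
  "unit_ball X N = {f \<in> X. N f \<le> 1}"

definition dual_norm ::
    "('a \<Rightarrow> real) set \<Rightarrow> (('a \<Rightarrow> real) \<Rightarrow> real) \<Rightarrow> (('a \<Rightarrow> real) \<Rightarrow> real) \<Rightarrow> real" where
  "dual_norm X N L = (SUP f\<in>unit_ball X N. \<bar>L f\<bar>)"

definition dual_sphere ::
    "('a \<Rightarrow> real) set \<Rightarrow> (('a \<Rightarrow> real) \<Rightarrow> real) \<Rightarrow> (('a \<Rightarrow> real) \<Rightarrow> real) set" where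
  "dual_sphere X N = {L. bounded_functional X N L \<and> dual_norm X N L = 1}"

definition slice ::
    "('a \<Rightarrow> real) set \<Rightarrow> (('a \<Rightarrow> real) \<Rightarrow> real) \<Rightarrow> (('a \<Rightarrow> real) \<Rightarrow> real) \<Rightarrow> real
      \<Rightarrow> ('a \<Rightarrow> real) set" where
  "slice X N L \<epsilon> = {f \<in> unit_ball X N. L f > 1 - \<epsilon>}"

definition slices ::
    "('a \<Rightarrow> real) set \<Rightarrow> (('a \<Rightarrow> real) \<Rightarrow> real) \<Rightarrow> ('a \<Rightarrow> real) set set" where
  "slices X N = {slice X N L \<epsilon> | L \<epsilon>. L \<in> dual_sphere X N \<and> \<epsilon> > 0}"

definition convex_combinations_of_slices ::
    "('a \<Rightarrow> real) set \<Rightarrow> (('a \<Rightarrow> real) \<Rightarrow> real) \<Rightarrow> ('a \<Rightarrow> real) set set" where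
  "convex_combinations_of_slices X N =
     {{(\<lambda>t. \<Sum>i<n. c i * h i t) | h. \<forall>i<n. h i \<in> S i} | (n::nat) c S.
        (\<forall>i<n. 0 \<le> c i \<and> S i \<in> slices X N) \<and> (\<Sum>i<n. c i) = 1}"

definition weak_topology ::
    "('a \<Rightarrow> real) set \<Rightarrow> (('a \<Rightarrow> real) \<Rightarrow> real) \<Rightarrow> ('a \<Rightarrow> real) topology" where
  "weak_topology X N =
     topology_generated_by {{f \<in> X. L f \<in> U} | L U. bounded_functional X N L \<and> open U}"

text \<open>The same convention as for the library constant \<^const>\<open>diameter\<close>.\<close>

definition norm_diameter :: "(('a \<Rightarrow> real) \<Rightarrow> real) \<Rightarrow> ('a \<Rightarrow> real) set \<Rightarrow> real" where
  "norm_diameter N A = (if A = {} then 0 else SUP (f, g)\<in>A \<times> A. N (\<lambda>t. f t - g t))"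

definition LD2P :: "('a \<Rightarrow> real) set \<Rightarrow> (('a \<Rightarrow> real) \<Rightarrow> real) \<Rightarrow> bool" where
  "LD2P X N \<longleftrightarrow> (\<forall>S\<in>slices X N. norm_diameter N S = 2)"

definition D2P :: "('a \<Rightarrow> real) set \<Rightarrow> (('a \<Rightarrow> real) \<Rightarrow> real) \<Rightarrow> bool" where
  "D2P X N \<longleftrightarrow>
     (\<forall>W. openin (subtopology (weak_topology X N) (unit_ball X N)) W \<and> W \<noteq> {}
        \<longrightarrow> norm_diameter N W = 2)"

definition SD2P :: "('a \<Rightarrow> real) set \<Rightarrow> (('a \<Rightarrow> real) \<Rightarrow> real) \<Rightarrow> bool" where
  "SD2P X N \<longleftrightarrow> (\<forall>C\<in>convex_combinations_of_slices X N. norm_diameter N C = 2)"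


section \<open>Orlicz functions\<close>

text \<open>Functions on the half line are total functions whose values at negative arguments are
  never used.\<close>

definition orlicz_function :: "(real \<Rightarrow> real) \<Rightarrow> bool" where
  "orlicz_function \<phi> \<longleftrightarrow>
     convex_on {0..} \<phi> \<and> (\<forall>u\<ge>0. 0 \<le> \<phi> u) \<and> \<phi> 0 = 0 \<and> (\<exists>u\<ge>0. \<phi> u \<noteq> 0)"

definition nondegenerate :: "(real \<Rightarrow> real) \<Rightarrow> bool" where
  "nondegenerate \<phi> \<longleftrightarrow> (\<forall>u>0. \<phi> u > 0)"

definition Delta2_zero :: "(real \<Rightarrow> real) \<Rightarrow> bool" where
  "Delta2_zero \<phi> \<longleftrightarrow> (\<exists>K>2. \<exists>u\<^sub>0>0. \<forall>u. 0 \<le> u \<and> u \<le> u\<^sub>0 \<longrightarrow> \<phi> (2 * u) \<le> K * \<phi> u)"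

definition Delta2_infinity :: "(real \<Rightarrow> real) \<Rightarrow> bool" where
  "Delta2_infinity \<phi> \<longleftrightarrow> (\<exists>K>2. \<exists>u\<^sub>0\<ge>0. \<forall>u\<ge>u\<^sub>0. \<phi> (2 * u) \<le> K * \<phi> u)"

definition Delta2 :: "(real \<Rightarrow> real) \<Rightarrow> bool" where
  "Delta2 \<phi> \<longleftrightarrow> Delta2_zero \<phi> \<and> Delta2_infinity \<phi>"

text \<open>Decreasing rearrangements may take the value \<open>\<infinity>\<close> (an infimum over the empty set),
  where \<open>\<phi>\<close> is extended by its limit \<open>\<infinity>\<close>.\<close>

definition extend_infinity :: "(real \<Rightarrow> real) \<Rightarrow> ennreal \<Rightarrow> ennreal" where
  "extend_infinity \<phi> u = (if u = \<infinity> then \<infinity> else ennreal (\<phi> (enn2real u)))"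


section \<open>Modular spaces, the Luxemburg norm and order continuity\<close>

definition distribution_function :: "'a measure \<Rightarrow> ('a \<Rightarrow> real) \<Rightarrow> real \<Rightarrow> ennreal" where
  "distribution_function M f s = emeasure M {t \<in> space M. \<bar>f t\<bar> > s}"

definition modular_space :: "'a measure \<Rightarrow> (('a \<Rightarrow> real) \<Rightarrow> ennreal) \<Rightarrow> ('a \<Rightarrow> real) set" where
  "modular_space M \<rho> = {f \<in> borel_measurable M. \<exists>k>0. \<rho> (\<lambda>t. k * f t) < \<infinity>}"

definition luxemburg_norm :: "(('a \<Rightarrow> real) \<Rightarrow> ennreal) \<Rightarrow> ('a \<Rightarrow> real) \<Rightarrow> real" where
  "luxemburg_norm \<rho> f = Inf {\<epsilon>. \<epsilon> > 0 \<and> \<rho> (\<lambda>t. f t / \<epsilon>) \<le> 1}"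

definition order_continuous_part ::
    "'a measure \<Rightarrow> ('a \<Rightarrow> real) set \<Rightarrow> (('a \<Rightarrow> real) \<Rightarrow> real) \<Rightarrow> ('a \<Rightarrow> real) set" where
  "order_continuous_part M X N =
     {f \<in> X. \<forall>g :: nat \<Rightarrow> 'a \<Rightarrow> real.
        (\<forall>n. g n \<in> X) \<and>
        (AE t in M. (\<forall>n. 0 \<le> g n t \<and> g n t \<le> \<bar>f t\<bar>) \<and>
                    decseq (\<lambda>n. g n t) \<and> (\<lambda>n. g n t) \<longlonglongrightarrow> 0)
        \<longrightarrow> decseq (\<lambda>n. N (g n)) \<and> (\<lambda>n. N (g n)) \<longlonglongrightarrow> 0}"


section \<open>Orlicz--Lorentz function spaces\<close>

definition interval_to :: "ereal \<Rightarrow> real set" where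
  "interval_to \<gamma> = {t. 0 \<le> t \<and> ereal t < \<gamma>}"

text \<open>The value of a weight at \<open>0\<close> is irrelevant and left unconstrained, so that
  weights unbounded near \<open>0\<close>, such as \<open>t powr (-1/2)\<close>, are included.\<close>

definition weight_function :: "ereal \<Rightarrow> (real \<Rightarrow> real) \<Rightarrow> bool" where
  "weight_function \<gamma> w \<longleftrightarrow>
     antimono_on (interval_to \<gamma> - {0}) w \<and>
     (\<forall>t\<in>interval_to \<gamma> - {0}. w t > 0) \<and>
     (\<forall>t\<in>interval_to \<gamma>. set_integrable lebesgue {0..t} w) \<and>
     (\<gamma> = \<infinity> \<longrightarrow> (\<integral>\<^sup>+t\<in>{0..}. ennreal (w t) \<partial>lebesgue) = \<infinity>)"

definition rearrangement :: "ereal \<Rightarrow> (real \<Rightarrow> real) \<Rightarrow> real \<Rightarrow> ennreal" where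
  "rearrangement \<gamma> f t =
     Inf {ennreal s | s. s > 0 \<and>
            distribution_function (lebesgue_on (interval_to \<gamma>)) f s \<le> ennreal t}"

definition rho :: "ereal \<Rightarrow> (real \<Rightarrow> real) \<Rightarrow> (real \<Rightarrow> real) \<Rightarrow> (real \<Rightarrow> real) \<Rightarrow> ennreal" where
  "rho \<gamma> \<phi> w f =
     (\<integral>\<^sup>+t. extend_infinity \<phi> (rearrangement \<gamma> f t) * ennreal (w t)
        \<partial>lebesgue_on (interval_to \<gamma>))"

definition Lambda_space :: "ereal \<Rightarrow> (real \<Rightarrow> real) \<Rightarrow> (real \<Rightarrow> real) \<Rightarrow> (real \<Rightarrow> real) set" where
  "Lambda_space \<gamma> \<phi> w = modular_space (lebesgue_on (interval_to \<gamma>)) (rho \<gamma> \<phi> w)"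

definition Lambda_norm ::
    "ereal \<Rightarrow> (real \<Rightarrow> real) \<Rightarrow> (real \<Rightarrow> real) \<Rightarrow> (real \<Rightarrow> real) \<Rightarrow> real" where
  "Lambda_norm \<gamma> \<phi> w = luxemburg_norm (rho \<gamma> \<phi> w)"

definition Lambda_oc :: "ereal \<Rightarrow> (real \<Rightarrow> real) \<Rightarrow> (real \<Rightarrow> real) \<Rightarrow> (real \<Rightarrow> real) set" where
  "Lambda_oc \<gamma> \<phi> w =
     order_continuous_part (lebesgue_on (interval_to \<gamma>)) (Lambda_space \<gamma> \<phi> w) (Lambda_norm \<gamma> \<phi> w)"


section \<open>Orlicz--Lorentz sequence spaces\<close>

text \<open>Sequences are indexed from \<open>0\<close>: the index \<open>i\<close> here stands for the position \<open>i + 1\<close>.\<close>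

definition weight_sequence :: "(nat \<Rightarrow> real) \<Rightarrow> bool" where
  "weight_sequence w \<longleftrightarrow> decseq w \<and> (\<forall>i. w i > 0) \<and> \<not> summable w"

definition seq_rearrangement :: "(nat \<Rightarrow> real) \<Rightarrow> nat \<Rightarrow> ennreal" where
  "seq_rearrangement x i =
     Inf {ennreal s | s. s > 0 \<and>
            distribution_function (count_space UNIV) x s < of_nat (i + 1)}"

definition alpha :: "(real \<Rightarrow> real) \<Rightarrow> (nat \<Rightarrow> real) \<Rightarrow> (nat \<Rightarrow> real) \<Rightarrow> ennreal" where
  "alpha \<phi> w x = (\<Sum>i. extend_infinity \<phi> (seq_rearrangement x i) * ennreal (w i))"

definition lambda_space :: "(real \<Rightarrow> real) \<Rightarrow> (nat \<Rightarrow> real) \<Rightarrow> (nat \<Rightarrow> real) set" where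
  "lambda_space \<phi> w = modular_space (count_space UNIV) (alpha \<phi> w)"

definition lambda_norm :: "(real \<Rightarrow> real) \<Rightarrow> (nat \<Rightarrow> real) \<Rightarrow> (nat \<Rightarrow> real) \<Rightarrow> real" where
  "lambda_norm \<phi> w = luxemburg_norm (alpha \<phi> w)"

definition lambda_oc :: "(real \<Rightarrow> real) \<Rightarrow> (nat \<Rightarrow> real) \<Rightarrow> (nat \<Rightarrow> real) set" where
  "lambda_oc \<phi> w =
     order_continuous_part (count_space UNIV) (lambda_space \<phi> w) (lambda_norm \<phi> w)"

end

theory Submission
  imports Defs
begin

text \<open>
  If \<open>\<phi>\<close> fails the appropriate \<open>\<Delta>\<^sub>2\<close>-condition, there are scaled indicators \<open>z\<^sub>k\<close> of disjoint
  sets \<open>B\<^sub>k\<close> whose modulars are at most \<open>2\<^sup>-\<^sup>k\<close> while \<open>(1 + \<delta>\<^sub>k) z\<^sub>k\<close> has modular larger than \<open>1\<close>, so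
  their norms tend to \<open>1\<close>. For \<open>f\<close> in the unit ball the functions obtained from \<open>f\<close> by replacing it on
  \<open>B\<^sub>k\<close> by \<open>z\<^sub>k\<close> or \<open>- z\<^sub>k\<close> have norm at most \<open>1 + 2\<^sup>-\<^sup>k\<close>. They converge weakly to \<open>f\<close>: all signed sums of
  the \<open>z\<^sub>k\<close>, and of the restrictions of \<open>f\<close> to the \<open>B\<^sub>k\<close>, lie in the unit ball, so a bounded functional
  is absolutely summable along both sequences. Their difference is \<open>2 z\<^sub>k\<close>, independently of \<open>f\<close>, so
  the same perturbation works simultaneously in all slices of a convex combination.

  Convexity and disjoint subadditivity of the modular come from a layer-cake decomposition in the
  weight and the function, which reduces them to the sublinearity in \<open>F\<close> of
  \<open>\<integral> min a (d\<^sub>F s) ds = min\<^sub>c (a c + \<integral> (\<bar>F\<bar> - c)\<^sup>+)\<close>.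
\<close>

section \<open>Seminormed function spaces\<close>

text \<open>The rearrangement of a sum is not dominated pointwise by the sum of the rearrangements,
  so the convexity of \<phi> does not pass to the modular pointwise in \<open>t\<close>; this is the
  obstacle behind the layer decomposition. Failure of doubling is used in the stronger-looking form
  that for all \<open>\<delta> > 0\<close> and \<open>K\<close> some \<open>u\<close>, small or
  large according to the condition that fails, satisfies
  \<open>\<phi> ((1 + \<delta>) * u) > K * \<phi> u\<close>: otherwise iterating the dilation until
  it exceeds 2 would give a doubling constant. With \<open>K\<close> of order 2^k this lifts a
  modular near 2^-k above 1. Function and sequence spaces differ only in the underlying measure
  spaces; the common argument asks merely that superlevel sets of the weight and initial segments be
  nested. The space and its order-continuous part are handled together: both are solid, and a
  bounded function carried by a set of finite measure and finite weight is order continuous whether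
  or not \<phi> is doubling. The dual space is never described, so singular functionals need no
  separate treatment.\<close>

locale seminormed_functions =
  fixes X :: "('a \<Rightarrow> real) set" and N :: "('a \<Rightarrow> real) \<Rightarrow> real"
  assumes zero_mem: "(\<lambda>t. 0) \<in> X"
    and add_mem: "\<And>f g. f \<in> X \<Longrightarrow> g \<in> X \<Longrightarrow> (\<lambda>t. f t + g t) \<in> X"
    and scale_mem: "\<And>c f. f \<in> X \<Longrightarrow> (\<lambda>t. c * f t) \<in> X"
    and norm_add: "\<And>f g. f \<in> X \<Longrightarrow> g \<in> X \<Longrightarrow> N (\<lambda>t. f t + g t) \<le> N f + N g"
    and norm_scale: "\<And>c f. f \<in> X \<Longrightarrow> N (\<lambda>t. c * f t) = \<bar>c\<bar> * N f"
begin

lemma norm_zero: "N (\<lambda>t. 0) = 0"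
  using norm_scale[OF zero_mem, of 0] by simp

lemma diff_mem: "f \<in> X \<Longrightarrow> g \<in> X \<Longrightarrow> (\<lambda>t. f t - g t) \<in> X"
  using add_mem[OF _ scale_mem, of f g "-1"] by simp

lemma norm_diff: "f \<in> X \<Longrightarrow> g \<in> X \<Longrightarrow> N (\<lambda>t. f t - g t) \<le> N f + N g"
  using norm_add[OF _ scale_mem, of f g "-1"] norm_scale[of g "-1"] by simp

lemma norm_nonneg: "f \<in> X \<Longrightarrow> 0 \<le> N f"
  using norm_diff[of f f] norm_zero by simp

lemma unit_ball_iff: "f \<in> unit_ball X N \<longleftrightarrow> f \<in> X \<and> N f \<le> 1"
  by (simp add: unit_ball_def)

lemma sum_mem:
  fixes n :: nat
  shows "(\<And>i. i < n \<Longrightarrow> h i \<in> X) \<Longrightarrow> (\<lambda>t. \<Sum>i<n. c i * h i t) \<in> X"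
  by (induction n) (auto simp: zero_mem add_mem scale_mem)

lemma norm_sum:
  fixes n :: nat
  shows "(\<And>i. i < n \<Longrightarrow> h i \<in> X) \<Longrightarrow> N (\<lambda>t. \<Sum>i<n. c i * h i t) \<le> (\<Sum>i<n. \<bar>c i\<bar> * N (h i))"
proof (induction n)
  case 0
  then show ?case by (simp add: norm_zero)
next
  case (Suc n)
  have "N (\<lambda>t. \<Sum>i<Suc n. c i * h i t) \<le> N (\<lambda>t. \<Sum>i<n. c i * h i t) + N (\<lambda>t. c n * h n t)"
    using norm_add[of "\<lambda>t. \<Sum>i<n. c i * h i t" "\<lambda>t. c n * h n t"] Suc.prems
    by (simp add: sum_mem scale_mem)
  with Suc show ?case by (fastforce simp: norm_scale)
qed

lemma convex_combination_mem_unit_ball: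
  fixes n :: nat
  assumes "\<And>i. i < n \<Longrightarrow> h i \<in> unit_ball X N" "\<And>i. i < n \<Longrightarrow> 0 \<le> c i" "(\<Sum>i<n. c i) = 1"
  shows "(\<lambda>t. \<Sum>i<n. c i * h i t) \<in> unit_ball X N"
proof -
  have "N (\<lambda>t. \<Sum>i<n. c i * h i t) \<le> (\<Sum>i<n. \<bar>c i\<bar> * N (h i))"
    using assms by (intro norm_sum) (auto simp: unit_ball_iff)
  also have "\<dots> \<le> (\<Sum>i<n. c i * 1)"
    using assms by (intro sum_mono) (auto simp: unit_ball_iff mult_left_le)
  finally show ?thesis
    using assms sum_mem[of n h c] by (auto simp: unit_ball_iff)
qed

lemma norm_diameter_eq_2:
  assumes sub: "A \<subseteq> unit_ball X N"
    and big: "\<And>\<epsilon>. \<epsilon> > 0 \<Longrightarrow> \<exists>f\<in>A. \<exists>g\<in>A. N (\<lambda>t. f t - g t) \<ge> 2 - \<epsilon>"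
  shows "norm_diameter N A = 2"
proof -
  have ne: "A \<noteq> {}" using big[of 1] by auto
  have le: "N (\<lambda>t. f t - g t) \<le> 2" if "f \<in> A" "g \<in> A" for f g
  proof -
    have "f \<in> X" "g \<in> X" "N f \<le> 1" "N g \<le> 1" using that sub by (auto simp: unit_ball_iff)
    with norm_diff[of f g] show ?thesis by simp
  qed
  let ?d = "\<lambda>(f, g). N (\<lambda>t. f t - g t)"
  have bdd: "bdd_above (?d ` (A \<times> A))"
    using le by (intro bdd_aboveI[of _ 2]) auto
  have "Sup (?d ` (A \<times> A)) \<le> 2"
    using le ne by (intro cSUP_least) auto
  moreover have "2 - \<epsilon> \<le> Sup (?d ` (A \<times> A))" if \<epsilon>: "\<epsilon> > 0" for \<epsilon>
  proof -
    obtain f g where "f \<in> A" "g \<in> A" "N (\<lambda>t. f t - g t) \<ge> 2 - \<epsilon>"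
      using big[OF \<epsilon>] by auto
    then show ?thesis
      using cSUP_upper2[OF bdd, of "(f, g)" "2 - \<epsilon>"] by auto
  qed
  ultimately have "Sup (?d ` (A \<times> A)) = 2"
    using field_le_epsilon[of 2 "Sup (?d ` (A \<times> A))"] by (force simp: diff_le_eq)
  with ne show ?thesis by (simp add: norm_diameter_def)
qed

end

section \<open>Bounded functionals along sequences, and weak neighbourhoods\<close>

lemma bounded_functional_sum:
  fixes n :: nat
  assumes L: "bounded_functional X N L" and X: "seminormed_functions X N"
    and "\<And>i. i < n \<Longrightarrow> h i \<in> X"
  shows "L (\<lambda>t. \<Sum>i<n. c i * h i t) = (\<Sum>i<n. c i * L (h i))"
proof -
  interpret seminormed_functions X N by fact
  from assms(3) show ?thesis
  proof (induction n)
    case 0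
    have "L (\<lambda>t. c * f t) = c * L f" if "f \<in> X" for c f
      using L that by (auto simp: bounded_functional_def)
    from this[OF zero_mem, of 0] show ?case by simp
  next
    case (Suc n)
    have "L (\<lambda>t. (\<Sum>i<n. c i * h i t) + c n * h n t)
        = L (\<lambda>t. \<Sum>i<n. c i * h i t) + L (\<lambda>t. c n * h n t)"
      using L sum_mem[of n h c] scale_mem[of "h n" "c n"] Suc.prems
      by (simp add: bounded_functional_def)
    moreover have "L (\<lambda>t. c n * h n t) = c n * L (h n)"
      using L Suc.prems unfolding bounded_functional_def by blast
    ultimately show ?case using Suc by simp
  qed
qed

text \<open>With the signs of \<open>L (v k)\<close> as coefficients, the signed sum is an element
  of the ball at which \<open>L\<close> takes the value of the partial sum of
  \<open>\<bar>L (v k)\<bar>\<close>; the resulting bound does not depend on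
  \<open>m\<close>.\<close>

lemma bounded_functional_tendsto_0:
  assumes L: "bounded_functional X N L" and X: "seminormed_functions X N"
    and v: "\<And>k::nat. v k \<in> X"
    and signs: "\<And>s m. (\<And>k. \<bar>s k\<bar> \<le> 1) \<Longrightarrow> N (\<lambda>t. \<Sum>k<m. s k * v k t) \<le> 1"
  shows "(\<lambda>k. L (v k)) \<longlonglongrightarrow> 0"
proof -
  interpret seminormed_functions X N by fact
  obtain C where C: "\<And>f. f \<in> X \<Longrightarrow> \<bar>L f\<bar> \<le> C * N f"
    using L unfolding bounded_functional_def by blast
  have "(\<Sum>k<m. \<bar>L (v k)\<bar>) \<le> \<bar>C\<bar>" for m
  proof -
    let ?g = "\<lambda>t. \<Sum>k<m. sgn (L (v k)) * v k t"
    have "(\<Sum>k<m. \<bar>L (v k)\<bar>) = L ?g"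
      using bounded_functional_sum[OF L X, of m v "\<lambda>k. sgn (L (v k))"] v
      by (simp add: abs_sgn mult.commute)
    also have "\<dots> \<le> C * N ?g" using C[of ?g] sum_mem[of m v] v by fastforce
    \<comment> \<open>The definition of \<open>bounded_functional\<close> does not force
      \<open>C\<close> to be nonnegative.\<close>
    also have "\<dots> \<le> \<bar>C\<bar> * 1"
      using signs[of "\<lambda>k. sgn (L (v k))" m] norm_nonneg[of ?g] sum_mem[of m v] v
      by (intro mult_mono) (auto simp: abs_sgn_eq)
    finally show ?thesis by simp
  qed
  then have "summable (\<lambda>k. \<bar>L (v k)\<bar>)"
    by (intro summableI_nonneg_bounded) auto
  then show ?thesis
    using summable_LIMSEQ_zero tendsto_rabs_zero_iff by blast
qed

text \<open>Eventual membership survives finite intersections and enlargement to a union, so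
  induction on the generation of \<open>W\<close> reduces the claim to the preimages of open sets
  under a single functional.\<close>

lemma eventually_mem_weakly_open:
  assumes W: "openin (weak_topology X N) W" and f: "f \<in> W"
    and g: "\<And>k::nat. g k \<in> X"
    and lim: "\<And>L. bounded_functional X N L \<Longrightarrow> (\<lambda>k. L (g k)) \<longlonglongrightarrow> L f"
  shows "\<forall>\<^sub>F k in sequentially. g k \<in> W"
proof -
  have "generate_topology_on {{f \<in> X. L f \<in> U} | L U. bounded_functional X N L \<and> open U} W"
    using W by (simp add: weak_topology_def openin_topology_generated_by_iff)
  then show ?thesis using f
  proof (induction rule: generate_topology_on.induct)
    case Empty
    then show ?case by simp
  next
    case (Int A B)
    then show ?case by (auto intro: eventually_conj)
  next
    case (UN K)
    then obtain A where "A \<in> K" "f \<in> A" by auto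
    with UN.IH[of A] show ?case by (auto elim: eventually_mono)
  next
    case (Basis S)
    then obtain L U where LU: "S = {f \<in> X. L f \<in> U}" "bounded_functional X N L" "open U" by auto
    with Basis lim[OF LU(2)] have "\<forall>\<^sub>F k in sequentially. L (g k) \<in> U"
      by (auto dest: topological_tendstoD)
    with g show ?case by (simp add: LU(1))
  qed
qed

section \<open>A common criterion for the three diameter two properties\<close>

text \<open>The quantifier order carries the argument: \<open>z\<close> is fixed first, and
  \<open>y\<close> may depend on \<open>f\<close> but not on the sign \<open>s\<close>. In a convex
  combination the \<open>y\<close> parts cancel between the two signs while the coefficients of
  \<open>z k\<close> add up to 1.\<close>

locale diameter_two_witness = seminormed_functions +
  fixes z :: "nat \<Rightarrow> 'a \<Rightarrow> real"
  assumes z_mem: "\<And>k. z k \<in> X"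
    and z_norm: "(\<lambda>k. N (z k)) \<longlonglongrightarrow> 1"
    and weak_perturbation: "\<And>f. f \<in> unit_ball X N \<Longrightarrow>
      \<exists>y. \<forall>s\<in>{1, -1}. (\<forall>k. (\<lambda>t. y k t + s * z k t) \<in> unit_ball X N) \<and>
        (\<forall>L. bounded_functional X N L \<longrightarrow> (\<lambda>k. L (\<lambda>t. y k t + s * z k t)) \<longlonglongrightarrow> L f)"
begin

lemma eventually_norm_z: "\<epsilon> > 0 \<Longrightarrow> \<forall>\<^sub>F k in sequentially. N (z k) > 1 - \<epsilon> / 2"
  using order_tendstoD(1)[OF z_norm, of "1 - \<epsilon> / 2"] by simp

lemma norm_double_z: "N (\<lambda>t. 2 * z k t) = 2 * N (z k)"
  using norm_scale[OF z_mem, of 2 k] by simp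

lemma slice_nonempty:
  assumes "S \<in> slices X N"
  shows "S \<noteq> {}"
proof -
  obtain L \<epsilon> where S: "S = slice X N L \<epsilon>" and L: "L \<in> dual_sphere X N" and \<epsilon>: "\<epsilon> > 0"
    using assms unfolding slices_def by auto
  \<comment> \<open>Otherwise the supremum defining the dual norm, taken over a ball that contains 0
    and is thus nonempty, would be below 1.\<close>
  have "\<not> (\<forall>f\<in>unit_ball X N. \<bar>L f\<bar> \<le> 1 - \<epsilon>)"
  proof
    assume "\<forall>f\<in>unit_ball X N. \<bar>L f\<bar> \<le> 1 - \<epsilon>"
    moreover have "(\<lambda>t. 0) \<in> unit_ball X N" using zero_mem norm_zero by (simp add: unit_ball_iff)
    then have "unit_ball X N \<noteq> {}" by blast
    ultimately have "dual_norm X N L \<le> 1 - \<epsilon>"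
      unfolding dual_norm_def by (intro cSUP_least) auto
    with L \<epsilon> show False by (simp add: dual_sphere_def)
  qed
  then obtain f where f: "f \<in> unit_ball X N" "\<bar>L f\<bar> > 1 - \<epsilon>" by force
  \<comment> \<open>The dual norm sees \<open>\<bar>L f\<bar>\<close> but a slice only
    \<open>L f\<close>, hence the factor \<open>sgn (L f)\<close>. If \<open>L f = 0\<close>, the
    result is the zero function, which is in the slice because then
    \<open>\<epsilon> > 1\<close>.\<close>
  have "(\<lambda>t. sgn (L f) * f t) \<in> unit_ball X N"
  proof -
    have "\<bar>sgn (L f)\<bar> * N f \<le> 1 * 1"
      using f(1) by (intro mult_mono) (auto simp: unit_ball_iff abs_sgn_eq norm_nonneg)
    then show ?thesis using f(1) by (simp add: unit_ball_iff norm_scale scale_mem)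
  qed
  moreover have "L (\<lambda>t. sgn (L f) * f t) = sgn (L f) * L f"
    using f(1) L by (auto simp: dual_sphere_def bounded_functional_def unit_ball_iff)
  ultimately have "(\<lambda>t. sgn (L f) * f t) \<in> S"
    using f(2) by (simp add: S slice_def abs_sgn mult.commute)
  then show ?thesis by auto
qed

lemma SD2P: "SD2P X N"
  unfolding SD2P_def
proof
  fix C assume "C \<in> convex_combinations_of_slices X N"
  then obtain n :: nat and c S where C: "C = {(\<lambda>t. \<Sum>i<n. c i * h i t) | h. \<forall>i<n. h i \<in> S i}"
    and cS: "\<And>i. i < n \<Longrightarrow> 0 \<le> c i" "\<And>i. i < n \<Longrightarrow> S i \<in> slices X N" and c1: "(\<Sum>i<n. c i) = 1"
    unfolding convex_combinations_of_slices_def by blast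
  have S_sub: "S i \<subseteq> unit_ball X N" if "i < n" for i
    using cS(2)[OF that] by (auto simp: slices_def slice_def)
  show "norm_diameter N C = 2"
  proof (rule norm_diameter_eq_2)
    show "C \<subseteq> unit_ball X N"
      using S_sub cS(1) c1 by (auto simp: C intro!: convex_combination_mem_unit_ball)
  next
    fix \<epsilon> :: real assume \<epsilon>: "\<epsilon> > 0"
    have "\<exists>y. \<forall>s\<in>{1, -1}. \<forall>\<^sub>F k in sequentially. (\<lambda>t. y k t + s * z k t) \<in> S i" if i: "i < n" for i
    proof -
      obtain L \<delta> where S: "S i = slice X N L \<delta>" and L: "bounded_functional X N L"
        using cS(2)[OF i] by (auto simp: slices_def dual_sphere_def)
      obtain f where f: "f \<in> unit_ball X N" "L f > 1 - \<delta>"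
        using slice_nonempty[OF cS(2)[OF i]] by (auto simp: S slice_def)
      obtain y where "\<forall>s\<in>{1, -1}. (\<forall>k. (\<lambda>t. y k t + s * z k t) \<in> unit_ball X N) \<and>
          (\<forall>L. bounded_functional X N L \<longrightarrow> (\<lambda>k. L (\<lambda>t. y k t + s * z k t)) \<longlonglongrightarrow> L f)"
        using weak_perturbation[OF f(1)] by (elim exE)
      then have y: "\<And>s k. s \<in> {1, -1} \<Longrightarrow> (\<lambda>t. y k t + s * z k t) \<in> unit_ball X N"
        "\<And>s. s \<in> {1, -1} \<Longrightarrow> (\<lambda>k. L (\<lambda>t. y k t + s * z k t)) \<longlonglongrightarrow> L f"
        using L by blast+
      have "\<forall>\<^sub>F k in sequentially. (\<lambda>t. y k t + s * z k t) \<in> S i" if s: "s \<in> {1, -1}" for s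
        using order_tendstoD(1)[OF y(2)[OF s] f(2)] y(1)[OF s] by (simp add: S slice_def)
      then show ?thesis by blast
    qed
    then have "\<forall>i\<in>{..<n}. \<exists>y. \<forall>s\<in>{1, -1}. \<forall>\<^sub>F k in sequentially. (\<lambda>t. y k t + s * z k t) \<in> S i"
      by simp
    from bchoice[OF this] obtain y where y: "\<forall>i\<in>{..<n}. \<forall>s\<in>{1, -1}.
        \<forall>\<^sub>F k in sequentially. (\<lambda>t. y i k t + s * z k t) \<in> S i"
      by blast
    \<comment> \<open>Finitely many eventual properties hold together, so a single index serves all
      slices and both signs.\<close>
    have "\<forall>\<^sub>F k in sequentially. \<forall>i\<in>{..<n}. \<forall>s\<in>{1, -1}. (\<lambda>t. y i k t + s * z k t) \<in> S i"
      using y by (intro eventually_ball_finite ballI) (auto intro: eventually_conj)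
    then have "\<forall>\<^sub>F k in sequentially. (\<forall>i\<in>{..<n}. \<forall>s\<in>{1, -1}. (\<lambda>t. y i k t + s * z k t) \<in> S i)
        \<and> N (z k) > 1 - \<epsilon> / 2"
      using eventually_norm_z[OF \<epsilon>] by (rule eventually_conj)
    then obtain k where "\<forall>i\<in>{..<n}. \<forall>s\<in>{1, -1}. (\<lambda>t. y i k t + s * z k t) \<in> S i"
      and k2: "N (z k) > 1 - \<epsilon> / 2"
      by (elim exE[OF eventually_happens'[OF sequentially_bot]] conjE)
    then have k: "\<And>i s. i < n \<Longrightarrow> s \<in> {1, -1} \<Longrightarrow> (\<lambda>t. y i k t + s * z k t) \<in> S i"
      by blast
    let ?f = "\<lambda>s t. \<Sum>i<n. c i * (y i k t + s * z k t)"
    have mem: "?f s \<in> C" if "s \<in> {1, -1}" for s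
      unfolding C mem_Collect_eq
      by (intro exI[of _ "\<lambda>i t. y i k t + s * z k t"] conjI refl allI impI k(1) that)
    have "(\<lambda>t. ?f 1 t - ?f (-1) t) = (\<lambda>t. 2 * z k t)"
    proof
      fix t
      have "?f 1 t - ?f (-1) t = (\<Sum>i<n. c i) * (2 * z k t)"
        unfolding sum_distrib_right sum_subtractf[symmetric] by (simp add: algebra_simps)
      then show "?f 1 t - ?f (-1) t = 2 * z k t" by (simp add: c1)
    qed
    with k2 have "N (\<lambda>t. ?f 1 t - ?f (-1) t) \<ge> 2 - \<epsilon>" by (simp add: norm_double_z)
    with mem[of 1] mem[of "-1"] show "\<exists>f\<in>C. \<exists>g\<in>C. N (\<lambda>t. f t - g t) \<ge> 2 - \<epsilon>"
      by (intro bexI[of _ "?f 1"] bexI[of _ "?f (-1)"]) simp_all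
  qed
qed

text \<open>The general passage from convex combinations of slices to weakly open sets is Bourgain's
  lemma. The witness makes it dispensable: weak convergence puts both perturbations into any weak
  neighbourhood of \<open>f\<close>.\<close>

lemma D2P: "D2P X N"
  unfolding D2P_def
proof (intro allI impI, elim conjE)
  fix W assume W: "openin (subtopology (weak_topology X N) (unit_ball X N)) W" "W \<noteq> {}"
  then obtain V where V: "openin (weak_topology X N) V" "W = V \<inter> unit_ball X N"
    by (auto simp: openin_subtopology)
  show "norm_diameter N W = 2"
  proof (rule norm_diameter_eq_2)
    show "W \<subseteq> unit_ball X N" using V by simp
  next
    fix \<epsilon> :: real assume \<epsilon>: "\<epsilon> > 0"
    obtain f where f: "f \<in> V" "f \<in> unit_ball X N" using W(2) V(2) by auto
    obtain y where "\<forall>s\<in>{1, -1}. (\<forall>k. (\<lambda>t. y k t + s * z k t) \<in> unit_ball X N) \<and>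
        (\<forall>L. bounded_functional X N L \<longrightarrow> (\<lambda>k. L (\<lambda>t. y k t + s * z k t)) \<longlonglongrightarrow> L f)"
      using weak_perturbation[OF f(2)] by (elim exE)
    then have y: "\<And>s k. s \<in> {1, -1} \<Longrightarrow> (\<lambda>t. y k t + s * z k t) \<in> unit_ball X N"
      "\<And>s L. s \<in> {1, -1} \<Longrightarrow> bounded_functional X N L \<Longrightarrow>
        (\<lambda>k. L (\<lambda>t. y k t + s * z k t)) \<longlonglongrightarrow> L f"
      by blast+
    have ev: "\<forall>\<^sub>F k in sequentially. (\<lambda>t. y k t + s * z k t) \<in> W" if s: "s \<in> {1, -1}" for s
      using eventually_mem_weakly_open[OF V(1) f(1), of "\<lambda>k t. y k t + s * z k t"] y(1)[OF s] y(2)[OF s]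
      by (simp add: V(2) unit_ball_iff)
    have "\<forall>\<^sub>F k in sequentially. ((\<lambda>t. y k t + 1 * z k t) \<in> W \<and> (\<lambda>t. y k t + (-1) * z k t) \<in> W)
        \<and> N (z k) > 1 - \<epsilon> / 2"
      using ev eventually_norm_z[OF \<epsilon>] by (intro eventually_conj) blast+
    then obtain k where k: "(\<lambda>t. y k t + 1 * z k t) \<in> W" "(\<lambda>t. y k t + (-1) * z k t) \<in> W"
      "N (z k) > 1 - \<epsilon> / 2"
      by (auto dest!: eventually_happens)
    have "N (\<lambda>t. (y k t + 1 * z k t) - (y k t + (-1) * z k t)) \<ge> 2 - \<epsilon>"
      using k(3) norm_double_z[of k] by (simp add: algebra_simps)
    with k(1,2) show "\<exists>f\<in>W. \<exists>g\<in>W. N (\<lambda>t. f t - g t) \<ge> 2 - \<epsilon>"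
      by (intro bexI[of _ "\<lambda>t. y k t + 1 * z k t"] bexI[of _ "\<lambda>t. y k t + (-1) * z k t"])
  qed
qed

lemma LD2P: "LD2P X N"
  unfolding LD2P_def
proof
  fix S assume S: "S \<in> slices X N"
  have "S = {(\<lambda>t. \<Sum>i<1. 1 * h i t) | h. \<forall>i<1::nat. h i \<in> S}"
  proof (intro equalityI subsetI)
    fix f assume "f \<in> S"
    then show "f \<in> {(\<lambda>t. \<Sum>i<1. 1 * h i t) | h. \<forall>i<1::nat. h i \<in> S}"
      by (intro CollectI exI[of _ "\<lambda>_. f"]) simp
  qed auto
  moreover have "(\<Sum>i<1::nat. 1::real) = 1" by simp
  ultimately have "S \<in> convex_combinations_of_slices X N"
    unfolding convex_combinations_of_slices_def mem_Collect_eq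
    using S by (intro exI[of _ 1] exI[of _ "\<lambda>_. 1"] exI[of _ "\<lambda>_. S"]) simp
  then show "norm_diameter N S = 2"
    using SD2P by (simp add: SD2P_def)
qed

end


section \<open>Modulars and Luxemburg norms\<close>

lemma order_continuous_partD:
  assumes "f \<in> order_continuous_part M X N" and "\<And>n. g n \<in> X"
    and "AE t in M. (\<forall>n. 0 \<le> g n t \<and> g n t \<le> \<bar>f t\<bar>) \<and> decseq (\<lambda>n. g n t) \<and> (\<lambda>n. g n t) \<longlonglongrightarrow> 0"
  shows "(\<lambda>n. N (g n)) \<longlonglongrightarrow> 0"
  using assms unfolding order_continuous_part_def by blast

text \<open>\<open>modular_disjoint\<close> is a separate axiom because convexity bounds the modular
  of a sum only by the average of the modulars of \<open>2 f\<close> and \<open>2 g\<close>, which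
  is out of control without doubling. \<open>modular_mono\<close> is stated almost everywhere so
  that null sets do not matter.\<close>

locale modular =
  fixes M :: "'a measure" and \<rho> :: "('a \<Rightarrow> real) \<Rightarrow> ennreal"
  assumes modular_mono: "\<And>f g. f \<in> borel_measurable M \<Longrightarrow> g \<in> borel_measurable M \<Longrightarrow>
      AE t in M. \<bar>f t\<bar> \<le> \<bar>g t\<bar> \<Longrightarrow> \<rho> f \<le> \<rho> g"
    and modular_convex: "\<And>f g a b. f \<in> borel_measurable M \<Longrightarrow> g \<in> borel_measurable M \<Longrightarrow>
      0 \<le> a \<Longrightarrow> 0 \<le> b \<Longrightarrow> a + b = 1 \<Longrightarrow>
      \<rho> (\<lambda>t. a * f t + b * g t) \<le> ennreal a * \<rho> f + ennreal b * \<rho> g"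
    and modular_disjoint: "\<And>f g. f \<in> borel_measurable M \<Longrightarrow> g \<in> borel_measurable M \<Longrightarrow>
      (\<And>t. f t = 0 \<or> g t = 0) \<Longrightarrow> \<rho> (\<lambda>t. f t + g t) \<le> \<rho> f + \<rho> g"
    and modular_zero: "\<rho> (\<lambda>t. 0) = 0"
begin

abbreviation "\<Lambda> \<equiv> modular_space M \<rho>"
abbreviation "N \<equiv> luxemburg_norm \<rho>"

lemma space_measurable [measurable_dest]: "f \<in> \<Lambda> \<Longrightarrow> f \<in> borel_measurable M"
  by (simp add: modular_space_def)

lemma modular_scale_le:
  assumes "f \<in> borel_measurable M" "0 \<le> a" "a \<le> 1"
  shows "\<rho> (\<lambda>t. a * f t) \<le> ennreal a * \<rho> f"
  using modular_convex[of f "\<lambda>t. 0" a "1 - a"] assms by (simp add: modular_zero)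

lemma norm_le:
  assumes "\<epsilon> > 0" "\<rho> (\<lambda>t. f t / \<epsilon>) \<le> 1"
  shows "N f \<le> \<epsilon>"
  unfolding luxemburg_norm_def using assms by (intro cInf_lower) (auto intro!: bdd_belowI[of _ 0])

text \<open>Ensures that the infimum in \<open>luxemburg_norm\<close> is taken over a nonempty
  set.\<close>

lemma admissible_nonempty:
  assumes "f \<in> \<Lambda>"
  shows "{\<epsilon>. \<epsilon> > 0 \<and> \<rho> (\<lambda>t. f t / \<epsilon>) \<le> 1} \<noteq> {}"
proof -
  obtain k where k: "k > 0" "\<rho> (\<lambda>t. k * f t) < \<infinity>" and [measurable]: "f \<in> borel_measurable M"
    using assms by (auto simp: modular_space_def)
  define r where "r = enn2real (\<rho> (\<lambda>t. k * f t))"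
  have r: "\<rho> (\<lambda>t. k * f t) = ennreal r" "r \<ge> 0" using k by (auto simp: r_def less_top)
  \<comment> \<open>Convexity through 0 reduces the modular \<open>r\<close> to at most
    \<open>a * r = r / (1 + r)\<close>.\<close>
  define a where "a = 1 / (1 + r)"
  have a: "0 < a" "a \<le> 1" "a * r \<le> 1" using r by (auto simp: a_def field_simps)
  have "\<rho> (\<lambda>t. a * (k * f t)) \<le> ennreal a * ennreal r"
    using modular_scale_le[of "\<lambda>t. k * f t" a] a r by simp
  also have "\<dots> \<le> 1" using a r by (simp flip: ennreal_mult)
  finally have "\<rho> (\<lambda>t. f t / (1 / (a * k))) \<le> 1" by (simp add: ac_simps)
  moreover have "1 / (a * k) > 0" using a k by simp
  ultimately show ?thesis by blast
qed

lemma norm_nonneg: "f \<in> \<Lambda> \<Longrightarrow> 0 \<le> N f"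
  unfolding luxemburg_norm_def using admissible_nonempty[of f] by (intro cInf_greatest) auto

text \<open>The hypothesis is strict because the axioms of \<open>modular\<close> contain no
  Fatou-type continuity that would make the infimum attained. Later arguments therefore keep a
  margin above the norm.\<close>

lemma modular_le_1:
  assumes f: "f \<in> \<Lambda>" and e: "N f < e"
  shows "\<rho> (\<lambda>t. f t / e) \<le> 1"
proof -
  note [measurable] = space_measurable[OF f]
  obtain \<epsilon> where \<epsilon>: "\<epsilon> > 0" "\<rho> (\<lambda>t. f t / \<epsilon>) \<le> 1" "\<epsilon> < e"
    using cInf_lessD[OF admissible_nonempty[OF f]] e unfolding luxemburg_norm_def by auto
  then have "\<rho> (\<lambda>t. f t / e) \<le> \<rho> (\<lambda>t. f t / \<epsilon>)"
    by (intro modular_mono) (auto simp: frac_le)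
  with \<epsilon> show ?thesis by auto
qed

lemma norm_leI:
  assumes a: "a \<ge> 0" and "\<And>e. e > a \<Longrightarrow> \<rho> (\<lambda>t. f t / e) \<le> 1"
  shows "N f \<le> a"
  using norm_le[of _ f] assms(2) a by (meson dense_ge le_less_trans)

lemma finite_modular_mem: "f \<in> borel_measurable M \<Longrightarrow> \<rho> f < \<infinity> \<Longrightarrow> f \<in> \<Lambda>"
  unfolding modular_space_def by (auto intro!: exI[of _ 1])

lemma space_solid:
  assumes f: "f \<in> \<Lambda>" and [measurable]: "h \<in> borel_measurable M" and "AE t in M. \<bar>h t\<bar> \<le> \<bar>f t\<bar>"
  shows "h \<in> \<Lambda>"
proof -
  note [measurable] = space_measurable[OF f]
  obtain k where k: "k > 0" "\<rho> (\<lambda>t. k * f t) < \<infinity>"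
    using f by (auto simp: modular_space_def)
  have "\<rho> (\<lambda>t. k * h t) \<le> \<rho> (\<lambda>t. k * f t)"
    using assms(3) k by (intro modular_mono) (auto elim!: eventually_mono simp: abs_mult)
  with k show ?thesis by (auto simp: modular_space_def intro!: exI[of _ k])
qed

lemma norm_mono:
  assumes f: "f \<in> \<Lambda>" and [measurable]: "h \<in> borel_measurable M" and "AE t in M. \<bar>h t\<bar> \<le> \<bar>f t\<bar>"
  shows "N h \<le> N f"
proof (rule norm_leI)
  fix e assume e: "e > N f"
  note [measurable] = space_measurable[OF f]
  have "\<rho> (\<lambda>t. h t / e) \<le> \<rho> (\<lambda>t. f t / e)"
    using assms(3) e norm_nonneg[OF f]
    by (intro modular_mono) (auto elim!: eventually_mono simp: divide_right_mono)
  with modular_le_1[OF f e] show "\<rho> (\<lambda>t. h t / e) \<le> 1" by (rule order_trans[rotated])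
qed (use norm_nonneg[OF f] in auto)

lemma space_scale:
  assumes f: "f \<in> \<Lambda>"
  shows "(\<lambda>t. c * f t) \<in> \<Lambda>"
proof -
  note [measurable] = space_measurable[OF f]
  obtain k where k: "k > 0" "\<rho> (\<lambda>t. k * f t) < \<infinity>"
    using f by (auto simp: modular_space_def)
  have "\<rho> (\<lambda>t. (k / (1 + \<bar>c\<bar>)) * (c * f t)) \<le> \<rho> (\<lambda>t. k * f t)"
    using k by (intro modular_mono) (auto simp: abs_mult field_simps mult_right_mono)
  with k show ?thesis
    by (auto simp: modular_space_def intro!: exI[of _ "k / (1 + \<bar>c\<bar>)"] add_pos_nonneg divide_pos_pos)
qed

text \<open>The classical reason for the triangle inequality of a Luxemburg norm: the quotient is a
  convex combination of \<open>f / a\<close> and \<open>g / b\<close>.\<close>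

lemma modular_add_div:
  assumes [measurable]: "f \<in> borel_measurable M" "g \<in> borel_measurable M"
    and ab: "a > 0" "b > 0" "\<rho> (\<lambda>t. f t / a) \<le> 1" "\<rho> (\<lambda>t. g t / b) \<le> 1"
  shows "\<rho> (\<lambda>t. (f t + g t) / (a + b)) \<le> 1"
proof -
  have "(\<lambda>t. (f t + g t) / (a + b)) = (\<lambda>t. a / (a + b) * (f t / a) + b / (a + b) * (g t / b))"
    using ab by (auto simp: add_divide_distrib)
  then have "\<rho> (\<lambda>t. (f t + g t) / (a + b)) = \<rho> (\<lambda>t. a / (a + b) * (f t / a) + b / (a + b) * (g t / b))"
    by simp
  also have "\<dots> \<le> ennreal (a / (a + b)) * \<rho> (\<lambda>t. f t / a) + ennreal (b / (a + b)) * \<rho> (\<lambda>t. g t / b)"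
    using ab by (intro modular_convex) (auto simp: add_divide_distrib[symmetric])
  also have "\<dots> \<le> ennreal (a / (a + b)) * 1 + ennreal (b / (a + b)) * 1"
    using ab by (intro add_mono mult_left_mono) auto
  also have "\<dots> = 1"
    using ab by (simp add: add_divide_distrib[symmetric] flip: ennreal_plus)
  finally show ?thesis .
qed

lemma norm_add:
  assumes f: "f \<in> \<Lambda>" and g: "g \<in> \<Lambda>"
  shows "N (\<lambda>t. f t + g t) \<le> N f + N g"
proof (rule norm_leI)
  note [measurable] = space_measurable[OF f] space_measurable[OF g]
  show "0 \<le> N f + N g" using norm_nonneg f g by simp
  fix e assume e: "e > N f + N g"
  define \<eta> where "\<eta> = (e - N f - N g) / 2"
  have \<eta>: "\<eta> > 0" "e = (N f + \<eta>) + (N g + \<eta>)" using e by (auto simp: \<eta>_def field_simps)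
  show "\<rho> (\<lambda>t. (f t + g t) / e) \<le> 1"
    unfolding \<eta>(2) using \<eta>(1) norm_nonneg[OF f] norm_nonneg[OF g]
    by (intro modular_add_div modular_le_1 f g) auto
qed

lemma space_add:
  assumes f: "f \<in> \<Lambda>" and g: "g \<in> \<Lambda>"
  shows "(\<lambda>t. f t + g t) \<in> \<Lambda>"
proof -
  note [measurable] = space_measurable[OF f] space_measurable[OF g]
  have "\<rho> (\<lambda>t. (f t + g t) / ((N f + 1) + (N g + 1))) \<le> 1"
    using norm_nonneg[OF f] norm_nonneg[OF g] by (intro modular_add_div modular_le_1 f g) auto
  then have "(\<lambda>t. (f t + g t) / ((N f + 1) + (N g + 1))) \<in> \<Lambda>"
    by (intro finite_modular_mem) (auto simp: le_less_trans)
  from space_scale[OF this, of "(N f + 1) + (N g + 1)"] show ?thesis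
    using norm_nonneg[OF f] norm_nonneg[OF g] by simp
qed

lemma norm_scale:
  assumes f: "f \<in> \<Lambda>"
  shows "N (\<lambda>t. c * f t) = \<bar>c\<bar> * N f"
proof -
  have le: "N (\<lambda>t. c * f t) \<le> \<bar>c\<bar> * N f" if "c \<noteq> 0" "f \<in> \<Lambda>" for c f
  proof (rule norm_leI)
    note [measurable] = space_measurable[OF that(2)]
    show "0 \<le> \<bar>c\<bar> * N f" using norm_nonneg that by simp
    fix e assume e: "e > \<bar>c\<bar> * N f"
    with that norm_nonneg[OF that(2)] have "e > 0" by (meson abs_ge_zero le_less_trans mult_nonneg_nonneg)
    have "\<rho> (\<lambda>t. c * f t / e) \<le> \<rho> (\<lambda>t. f t / (e / \<bar>c\<bar>))"
      using that \<open>e > 0\<close> by (intro modular_mono) (auto simp: abs_mult field_simps)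
    also have "\<dots> \<le> 1"
      using that e by (intro modular_le_1) (auto simp: field_simps)
    finally show "\<rho> (\<lambda>t. c * f t / e) \<le> 1" .
  qed
  show ?thesis
  proof (cases "c = 0")
    case True
    have "N (\<lambda>t. 0) \<le> 0" by (rule norm_leI) (auto simp: modular_zero)
    moreover have "0 \<le> N (\<lambda>t. 0)" using norm_nonneg[OF space_scale[OF f, of 0]] by simp
    ultimately show ?thesis using True by simp
  next
    case False
    \<comment> \<open>The reverse inequality is \<open>le\<close> for the factor
      \<open>1 / c\<close> and the function \<open>c f\<close>.\<close>
    have "N (\<lambda>t. (1 / c) * (c * f t)) \<le> \<bar>1 / c\<bar> * N (\<lambda>t. c * f t)"
      using False by (intro le space_scale f) auto
    with False have "\<bar>c\<bar> * N f \<le> N (\<lambda>t. c * f t)" by (simp add: field_simps)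
    with le[OF False f] show ?thesis by simp
  qed
qed

lemma norm_lowerI:
  assumes f: "f \<in> \<Lambda>" and "a > 0" "\<rho> (\<lambda>t. f t / a) > 1"
  shows "N f \<ge> a"
  using modular_le_1[OF f, of a] assms(3) by (meson not_le)

lemma space_zero: "(\<lambda>t. 0) \<in> \<Lambda>"
  by (rule finite_modular_mem) (auto simp: modular_zero)

section \<open>Solid subspaces of the modular space\<close>

text \<open>Closure under scalars is not listed because it follows: integer multiples are repeated
  sums and dominate all other multiples. The notion covers the whole space and its order-continuous
  part at once.\<close>

definition ideal :: "('a \<Rightarrow> real) set \<Rightarrow> bool" where
  "ideal X \<longleftrightarrow> X \<subseteq> \<Lambda> \<and> X \<noteq> {} \<and> (\<forall>f\<in>X. \<forall>g\<in>X. (\<lambda>t. f t + g t) \<in> X) \<and>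
     (\<forall>f\<in>X. \<forall>h\<in>borel_measurable M. (\<forall>t. \<bar>h t\<bar> \<le> \<bar>f t\<bar>) \<longrightarrow> h \<in> X)"

lemma ideal_space: "ideal \<Lambda>"
  using space_zero by (auto simp: ideal_def space_add intro: space_solid)

lemma seminormed_ideal:
  assumes "ideal X"
  shows "seminormed_functions X N"
proof
  have sub: "f \<in> X \<Longrightarrow> f \<in> \<Lambda>" for f using assms by (auto simp: ideal_def)
  have solid: "h \<in> X" if "f \<in> X" "h \<in> borel_measurable M" "\<And>t. \<bar>h t\<bar> \<le> \<bar>f t\<bar>" for f h
    using assms that unfolding ideal_def by blast
  show add: "(\<lambda>t. f t + g t) \<in> X" if "f \<in> X" "g \<in> X" for f g
    using assms that by (auto simp: ideal_def)
  obtain f where "f \<in> X" using assms by (auto simp: ideal_def)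
  then show zero: "(\<lambda>t. 0) \<in> X" by (rule solid) auto
  show "(\<lambda>t. c * f t) \<in> X" if f: "f \<in> X" for c f
  proof -
    obtain n :: nat where n: "\<bar>c\<bar> \<le> real n" using real_arch_simple by blast
    have "(\<lambda>t. real n * f t) \<in> X"
    proof (induction n)
      case 0
      then show ?case using zero by simp
    next
      case (Suc n)
      with add[OF f Suc] show ?case by (simp add: algebra_simps)
    qed
    then show ?thesis
      by (rule solid) (use n space_measurable[OF sub[OF f]] in \<open>auto simp: abs_mult mult_right_mono\<close>)
  qed
  show "N (\<lambda>t. f t + g t) \<le> N f + N g" if "f \<in> X" "g \<in> X" for f g
    by (intro norm_add sub that)
  show "N (\<lambda>t. c * f t) = \<bar>c\<bar> * N f" if "f \<in> X" for c f
    by (intro norm_scale sub that)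
qed

text \<open>Makes the monotonicity clause of \<open>order_continuous_part\<close> automatic, so that
  only convergence to 0 has to be shown.\<close>

lemma decseq_norm:
  fixes g :: "nat \<Rightarrow> 'a \<Rightarrow> real"
  assumes g: "\<And>n. g n \<in> \<Lambda>" and ae: "AE t in M. (\<forall>n. 0 \<le> g n t) \<and> decseq (\<lambda>n. g n t)"
  shows "decseq (\<lambda>n. N (g n))"
  unfolding decseq_Suc_iff
proof
  fix n
  have "AE t in M. \<bar>g (Suc n) t\<bar> \<le> \<bar>g n t\<bar>"
    by (rule eventually_mono[OF ae]) (simp add: decseq_Suc_iff)
  then show "N (g (Suc n)) \<le> N (g n)"
    by (rule norm_mono[OF g space_measurable[OF g]])
qed

text \<open>For sums, a Riesz decomposition splits a sequence below \<open>\<bar>f + h\<bar>\<close>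
  into its minimum with \<open>\<bar>f\<bar>\<close> and the remainder. The remainder is below
  \<open>\<bar>h\<bar>\<close>, and both pieces again decrease to 0.\<close>

lemma ideal_order_continuous_part: "ideal (order_continuous_part M \<Lambda> N)"
  unfolding ideal_def
proof (intro conjI ballI impI)
  let ?A = "order_continuous_part M \<Lambda> N"
  show "?A \<subseteq> \<Lambda>" by (auto simp: order_continuous_part_def)
  have zero: "N (g n) = 0" if "g n \<in> \<Lambda>" "AE t in M. (\<forall>n. 0 \<le> g n t \<and> g n t \<le> \<bar>0\<bar>)" for g :: "nat \<Rightarrow> 'a \<Rightarrow> real" and n
  proof -
    have "N (g n) \<le> N (\<lambda>t. 0)"
    proof (rule norm_mono[OF space_zero space_measurable[OF that(1)]])
      show "AE t in M. \<bar>g n t\<bar> \<le> \<bar>0\<bar>" by (rule eventually_mono[OF that(2)]) auto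
    qed
    also have "\<dots> = 0" using norm_scale[OF space_zero, of 0] by simp
    finally show ?thesis using norm_nonneg[OF that(1)] by simp
  qed
  have "(\<lambda>t. 0) \<in> ?A"
    unfolding order_continuous_part_def
  proof (intro CollectI conjI allI impI space_zero, goal_cases)
    case (1 g)
    then have "AE t in M. (\<forall>n. 0 \<le> g n t \<and> g n t \<le> \<bar>0\<bar>)" by (auto elim: eventually_mono)
    with 1 zero show ?case by (simp add: decseq_def)
  next
    case (2 g)
    then have "AE t in M. (\<forall>n. 0 \<le> g n t \<and> g n t \<le> \<bar>0\<bar>)" by (auto elim: eventually_mono)
    with 2 zero show ?case by simp
  qed
  then show "?A \<noteq> {}" by auto
  show "h \<in> ?A" if f: "f \<in> ?A" and [measurable]: "h \<in> borel_measurable M"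
    and le: "\<forall>t. \<bar>h t\<bar> \<le> \<bar>f t\<bar>" for f h
  proof -
    have "f \<in> \<Lambda>" using f by (simp add: order_continuous_part_def)
    then have "h \<in> \<Lambda>" by (rule space_solid) (use le in auto)
    moreover have "AE t in M. (\<forall>n. 0 \<le> g n t \<and> g n t \<le> \<bar>f t\<bar>) \<and> decseq (\<lambda>n. g n t) \<and> (\<lambda>n. g n t) \<longlonglongrightarrow> 0"
      if "AE t in M. (\<forall>n. 0 \<le> g n t \<and> g n t \<le> \<bar>h t\<bar>) \<and> decseq (\<lambda>n. g n t) \<and> (\<lambda>n. g n t) \<longlonglongrightarrow> 0" for g :: "nat \<Rightarrow> 'a \<Rightarrow> real"
      by (rule eventually_mono[OF that]) (use le order_trans in blast)
    ultimately show ?thesis using f unfolding order_continuous_part_def by blast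
  qed
  show "(\<lambda>t. f t + h t) \<in> ?A" if f: "f \<in> ?A" and h: "h \<in> ?A" for f h
  proof -
    have \<Lambda>: "f \<in> \<Lambda>" "h \<in> \<Lambda>" using f h by (auto simp: order_continuous_part_def)
    note [measurable] = space_measurable[OF \<Lambda>(1)] space_measurable[OF \<Lambda>(2)]
    have "(\<lambda>n. N (g n)) \<longlonglongrightarrow> 0" if g: "\<And>n. g n \<in> \<Lambda>"
      and ae: "AE t in M. (\<forall>n. 0 \<le> g n t \<and> g n t \<le> \<bar>f t + h t\<bar>) \<and> decseq (\<lambda>n. g n t) \<and> (\<lambda>n. g n t) \<longlonglongrightarrow> 0"
    for g :: "nat \<Rightarrow> 'a \<Rightarrow> real"
    proof -
      note [measurable] = space_measurable[OF g]
      let ?p = "\<lambda>n t. min (g n t) \<bar>f t\<bar>" and ?q = "\<lambda>n t. max (g n t - \<bar>f t\<bar>) 0"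
      have p: "?p n \<in> \<Lambda>" for n
      proof (rule space_solid[OF \<Lambda>(1)])
        show "AE t in M. \<bar>?p n t\<bar> \<le> \<bar>f t\<bar>" by (rule eventually_mono[OF ae]) auto
      qed auto
      have q: "?q n \<in> \<Lambda>" for n
      proof (rule space_solid[OF g[of n]])
        show "AE t in M. \<bar>?q n t\<bar> \<le> \<bar>g n t\<bar>" by (rule eventually_mono[OF ae]) (auto simp: max_def)
      qed auto
      have aep: "AE t in M. (\<forall>n. 0 \<le> ?p n t \<and> ?p n t \<le> \<bar>f t\<bar>) \<and> decseq (\<lambda>n. ?p n t) \<and> (\<lambda>n. ?p n t) \<longlonglongrightarrow> 0"
        using ae
      proof (rule eventually_mono, elim conjE, intro conjI)
        fix t assume t: "\<forall>n. 0 \<le> g n t \<and> g n t \<le> \<bar>f t + h t\<bar>" "decseq (\<lambda>n. g n t)" "(\<lambda>n. g n t) \<longlonglongrightarrow> 0"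
        show "\<forall>n. 0 \<le> ?p n t \<and> ?p n t \<le> \<bar>f t\<bar>" using t(1) by auto
        show "decseq (\<lambda>n. ?p n t)" using t(2) unfolding decseq_def by (meson min.mono order_refl)
        show "(\<lambda>n. ?p n t) \<longlonglongrightarrow> 0" using tendsto_min[OF t(3) tendsto_const, of "\<bar>f t\<bar>"] by simp
      qed
      have aeq: "AE t in M. (\<forall>n. 0 \<le> ?q n t \<and> ?q n t \<le> \<bar>h t\<bar>) \<and> decseq (\<lambda>n. ?q n t) \<and> (\<lambda>n. ?q n t) \<longlonglongrightarrow> 0"
        using ae
      proof (rule eventually_mono, elim conjE, intro conjI)
        fix t assume t: "\<forall>n. 0 \<le> g n t \<and> g n t \<le> \<bar>f t + h t\<bar>" "decseq (\<lambda>n. g n t)" "(\<lambda>n. g n t) \<longlonglongrightarrow> 0"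
        have "g n t - \<bar>f t\<bar> \<le> \<bar>h t\<bar>" for n using t(1) abs_triangle_ineq[of "f t" "h t"] by (smt (verit))
        then show "\<forall>n. 0 \<le> ?q n t \<and> ?q n t \<le> \<bar>h t\<bar>" by auto
        show "decseq (\<lambda>n. ?q n t)" using t(2) unfolding decseq_def
          by (meson diff_right_mono max.mono order_refl)
        have "(\<lambda>n. ?q n t) \<longlonglongrightarrow> max (0 - \<bar>f t\<bar>) 0" by (intro tendsto_intros t(3))
        then show "(\<lambda>n. ?q n t) \<longlonglongrightarrow> 0" by simp
      qed
      have "(\<lambda>n. N (?p n)) \<longlonglongrightarrow> 0" by (rule order_continuous_partD[OF f p aep])
      moreover have "(\<lambda>n. N (?q n)) \<longlonglongrightarrow> 0" by (rule order_continuous_partD[OF h q aeq])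
      ultimately have lim: "(\<lambda>n. N (?p n) + N (?q n)) \<longlonglongrightarrow> 0"
        using tendsto_add[of "\<lambda>n. N (?p n)" 0 sequentially "\<lambda>n. N (?q n)" 0] by simp
      have "N (g n) \<le> N (?p n) + N (?q n)" for n
      proof -
        have "(\<lambda>t. ?p n t + ?q n t) = g n" by auto
        with norm_add[OF p q, of n n] show ?thesis by simp
      qed
      with lim show ?thesis
        using norm_nonneg[OF g] by (intro tendsto_sandwich[OF _ _ tendsto_const lim]) auto
    qed
    moreover have "decseq (\<lambda>n. N (g n))" if "\<And>n. g n \<in> \<Lambda>"
      "AE t in M. (\<forall>n. 0 \<le> g n t \<and> g n t \<le> \<bar>f t + h t\<bar>) \<and> decseq (\<lambda>n. g n t) \<and> (\<lambda>n. g n t) \<longlonglongrightarrow> 0"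
    for g :: "nat \<Rightarrow> 'a \<Rightarrow> real"
      by (rule decseq_norm[OF that(1)], rule eventually_mono[OF that(2)]) simp
    ultimately show ?thesis
      using space_add[OF \<Lambda>] unfolding order_continuous_part_def by blast
  qed
qed


section \<open>Diameter two from disjoint blocks\<close>

lemma modular_disjoint_sum:
  fixes m :: nat
  assumes [measurable]: "\<And>k. v k \<in> borel_measurable M"
    and B: "disjoint_family B" and v0: "\<And>k t. t \<notin> B k \<Longrightarrow> v k t = 0"
  shows "\<rho> (\<lambda>t. \<Sum>k<m. v k t) \<le> (\<Sum>k<m. \<rho> (v k))"
proof (induction m)
  case 0
  then show ?case by (simp add: modular_zero)
next
  case (Suc m)
  have "(\<Sum>k<m. v k t) = 0 \<or> v m t = 0" for t
  proof (cases "t \<in> B m")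
    case True
    then have "t \<notin> B k" if "k < m" for k
      using disjoint_family_onD[OF B, of k m] that by auto
    then have "(\<Sum>k<m. v k t) = 0" by (intro sum.neutral) (simp add: v0)
    then show ?thesis ..
  next
    case False
    then show ?thesis by (simp add: v0)
  qed
  then have "\<rho> (\<lambda>t. (\<Sum>k<m. v k t) + v m t) \<le> \<rho> (\<lambda>t. \<Sum>k<m. v k t) + \<rho> (v m)"
    by (intro modular_disjoint) auto
  also have "\<dots> \<le> (\<Sum>k<m. \<rho> (v k)) + \<rho> (v m)" using Suc by (rule add_right_mono)
  finally show ?case by simp
qed

lemma diameter_two_properties:
  fixes z :: "nat \<Rightarrow> 'a \<Rightarrow> real" and B :: "nat \<Rightarrow> 'a set" and \<delta> :: "nat \<Rightarrow> real"
  assumes X: "ideal X" and z: "\<And>k. z k \<in> X"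
    and B: "disjoint_family B" "\<And>k. B k \<in> sets M" and z0: "\<And>k t. t \<notin> B k \<Longrightarrow> z k t = 0"
    and small: "\<And>k. \<rho> (z k) \<le> ennreal ((1/2) ^ Suc k)"
    and \<delta>: "\<And>k. \<delta> k > 0" "\<delta> \<longlonglongrightarrow> 0"
    and large: "\<And>k. \<rho> (\<lambda>t. (1 + \<delta> k) * z k t) > 1"
  shows "SD2P X N \<and> D2P X N \<and> LD2P X N"
proof -
  interpret seminormed_functions X N by (rule seminormed_ideal[OF X])
  have sub: "f \<in> X \<Longrightarrow> f \<in> \<Lambda>" for f using X by (auto simp: ideal_def)
  have solid: "h \<in> X" if "f \<in> X" "h \<in> borel_measurable M" "\<And>t. \<bar>h t\<bar> \<le> \<bar>f t\<bar>" for f h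
    using X that unfolding ideal_def by blast
  note [measurable] = space_measurable[OF sub[OF z]] B(2)
  \<comment> \<open>The bound of \<open>small\<close>. Its partial sums stay below 1, so every
    signed sum of the \<open>z k\<close> has modular at most 1.\<close>
  define \<eta> :: "nat \<Rightarrow> real" where "\<eta> k = (1/2) ^ Suc k" for k
  have \<eta>: "\<eta> k > 0" for k by (simp add: \<eta>_def)
  have \<eta>0: "\<eta> \<longlonglongrightarrow> 0"
    unfolding \<eta>_def by (rule LIMSEQ_Suc[OF LIMSEQ_realpow_zero]) auto
  have small_sum: "(\<Sum>k<m. \<rho> (z k)) \<le> 1" for m
  proof -
    have "(\<Sum>k<m. (1/2::real) ^ Suc k) = 1 - (1/2) ^ m" by (induction m) (auto simp: field_simps)
    then have "(\<Sum>k<m. (1/2::real) ^ Suc k) \<le> 1" by simp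
    then have "(\<Sum>k<m. ennreal ((1/2) ^ Suc k)) \<le> 1"
      by (subst sum_ennreal) (auto simp del: power_Suc)
    with sum_mono[of "{..<m}" "\<lambda>k. \<rho> (z k)" "\<lambda>k. ennreal ((1/2) ^ Suc k)"] small show ?thesis
      by (meson order_trans)
  qed
  have z_signs: "N (\<lambda>t. \<Sum>k<m. s k * z k t) \<le> 1" if s: "\<And>k. \<bar>s k\<bar> \<le> 1" for s m
  proof -
    have "\<rho> (\<lambda>t. \<Sum>k<m. s k * z k t) \<le> (\<Sum>k<m. \<rho> (\<lambda>t. s k * z k t))"
      by (intro modular_disjoint_sum[OF _ B(1)]) (auto simp: z0)
    also have "\<dots> \<le> (\<Sum>k<m. \<rho> (z k))"
      using s by (intro sum_mono modular_mono) (auto simp: abs_mult mult_left_le_one_le)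
    also note small_sum
    finally show ?thesis by (intro norm_le) auto
  qed
  have Lz: "(\<lambda>k. L (z k)) \<longlonglongrightarrow> 0" if "bounded_functional X N L" for L
    by (rule bounded_functional_tendsto_0[OF that seminormed_functions_axioms z z_signs])
  have norm_z: "1 / (1 + \<delta> k) \<le> N (z k)" "N (z k) \<le> 1" for k
  proof -
    show "1 / (1 + \<delta> k) \<le> N (z k)"
      using large[of k] \<delta>(1)[of k] by (intro norm_lowerI sub z) (auto simp: mult.commute)
    have "\<eta> k \<le> 1" by (simp add: \<eta>_def power_le_one del: power_Suc)
    then have "ennreal (\<eta> k) \<le> 1" by simp
    with small[of k] have "\<rho> (z k) \<le> 1" unfolding \<eta>_def by (rule order_trans)
    then show "N (z k) \<le> 1" by (intro norm_le) auto
  qed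
  \<comment> \<open>Next to \<open>f\<close>, the function \<open>z k\<close> may raise the modular
    to \<open>1 + \<eta> k\<close>; by convexity, dividing by this number leads back to the unit
    ball. The factor tends to 1, so no limit changes.\<close>
  define z' where "z' k t = 1 / (1 + \<eta> k) * z k t" for k t
  have z'_mem: "z' k \<in> X" for k unfolding z'_def by (rule scale_mem[OF z])
  have lim\<eta>: "(\<lambda>k. 1 / (1 + \<eta> k)) \<longlonglongrightarrow> 1"
    using tendsto_divide[OF tendsto_const tendsto_add[OF tendsto_const \<eta>0], of 1 1] by simp
  have "diameter_two_witness X N z'"
  proof
    show "z' k \<in> X" for k by (rule z'_mem)
    have "(\<lambda>k. 1 / (1 + \<delta> k)) \<longlonglongrightarrow> 1"
      using tendsto_divide[OF tendsto_const tendsto_add[OF tendsto_const \<delta>(2)], of 1 1] by simp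
    then have "(\<lambda>k. N (z k)) \<longlonglongrightarrow> 1"
      by (rule tendsto_sandwich[OF _ _ _ tendsto_const, rotated 2]) (auto simp: norm_z)
    then have "(\<lambda>k. 1 / (1 + \<eta> k) * N (z k)) \<longlonglongrightarrow> 1 * 1"
      by (intro tendsto_mult lim\<eta>)
    moreover have "N (z' k) = 1 / (1 + \<eta> k) * N (z k)" for k
      unfolding z'_def using norm_scale[OF z, of "1 / (1 + \<eta> k)" k] \<eta>[of k] by simp
    ultimately show "(\<lambda>k. N (z' k)) \<longlonglongrightarrow> 1" by simp
  next
    fix f assume f: "f \<in> unit_ball X N"
    then have fX: "f \<in> X" and f1: "N f \<le> 1" by (auto simp: unit_ball_def)
    note [measurable] = space_measurable[OF sub[OF fX]]
    define v where "v k t = f t * indicator (B k) t" for k t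
    define u where "u k t = f t - v k t" for k t
    have v_meas [measurable]: "v k \<in> borel_measurable M" for k unfolding v_def by measurable
    have u_meas [measurable]: "u k \<in> borel_measurable M" for k unfolding u_def by measurable
    have v_mem: "v k \<in> X" for k by (rule solid[OF fX]) (auto simp: v_def indicator_def)
    have u_mem: "u k \<in> X" for k unfolding u_def by (rule diff_mem[OF fX v_mem])
    have v_signs: "N (\<lambda>t. \<Sum>k<m. s k * v k t) \<le> 1" if s: "\<And>k. \<bar>s k\<bar> \<le> 1" for s m
    proof -
      have "\<bar>\<Sum>k<m. s k * v k t\<bar> \<le> \<bar>f t\<bar>" for t
      proof (cases "\<exists>j<m. t \<in> B j")
        case True
        then obtain j where j: "j < m" "t \<in> B j" by auto
        then have "t \<notin> B k" if "k \<noteq> j" for k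
          using disjoint_family_onD[OF B(1), of k j] that by auto
        then have "(\<Sum>k<m. s k * v k t) = (\<Sum>k\<in>{j}. s k * v k t)"
          using j by (intro sum.mono_neutral_right) (auto simp: v_def)
        then show ?thesis
          using s[of j] j(2) by (simp add: v_def abs_mult mult_left_le_one_le)
      qed (auto simp: v_def)
      then have "N (\<lambda>t. \<Sum>k<m. s k * v k t) \<le> N f"
        by (intro norm_mono sub fX) auto
      with f1 show ?thesis by simp
    qed
    have Lv: "(\<lambda>k. L (v k)) \<longlonglongrightarrow> 0" if "bounded_functional X N L" for L
      by (rule bounded_functional_tendsto_0[OF that seminormed_functions_axioms v_mem v_signs])
    \<comment> \<open>The factor \<open>1 / (1 + \<eta> k)\<close> occurs twice. The inner one
      secures modular at most 1 for the part off \<open>B k\<close> even if \<open>N f = 1\<close>,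
      where \<open>modular_le_1\<close> requires a strict margin; the outer one pays for
      \<open>z k\<close>, as in \<open>z'\<close>.\<close>
    define y where "y k t = 1 / (1 + \<eta> k) * (1 / (1 + \<eta> k) * u k t)" for k t
    have ball: "(\<lambda>t. y k t + s * z' k t) \<in> unit_ball X N" if s: "\<bar>s\<bar> = 1" for s k
    proof -
      have mem: "(\<lambda>t. y k t + s * z' k t) \<in> X"
        unfolding y_def by (intro add_mem scale_mem u_mem z'_mem)
      let ?g = "\<lambda>t. 1 / (1 + \<eta> k) * u k t + s * z k t"
      have g_le: "\<rho> ?g \<le> ennreal (1 + \<eta> k)"
      proof -
        have "\<rho> ?g \<le> \<rho> (\<lambda>t. 1 / (1 + \<eta> k) * u k t) + \<rho> (\<lambda>t. s * z k t)"
          by (intro modular_disjoint) (auto simp: u_def v_def indicator_def z0)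
        also have "\<rho> (\<lambda>t. 1 / (1 + \<eta> k) * u k t) \<le> \<rho> (\<lambda>t. f t / (1 + \<eta> k))"
          using \<eta>[of k] by (intro modular_mono) (auto simp: u_def v_def indicator_def abs_mult)
        also have "\<dots> \<le> 1"
          using f1 \<eta>[of k] by (intro modular_le_1 sub fX) auto
        also have "\<rho> (\<lambda>t. s * z k t) \<le> \<rho> (z k)"
          using s by (intro modular_mono) (auto simp: abs_mult)
        also have "\<dots> \<le> ennreal (\<eta> k)" using small[of k] by (simp add: \<eta>_def)
        finally show ?thesis
          using \<eta>[of k] by (simp add: ennreal_plus add_left_mono add_right_mono)
      qed
      have "\<rho> (\<lambda>t. 1 / (1 + \<eta> k) * ?g t) \<le> ennreal (1 / (1 + \<eta> k)) * \<rho> ?g"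
        using \<eta>[of k] by (intro modular_scale_le) auto
      also have "\<dots> \<le> ennreal (1 / (1 + \<eta> k)) * ennreal (1 + \<eta> k)"
        by (intro mult_left_mono g_le) auto
      also have "\<dots> = 1"
        using \<eta>[of k] by (subst ennreal_mult[symmetric]) auto
      also have "(\<lambda>t. 1 / (1 + \<eta> k) * ?g t) = (\<lambda>t. y k t + s * z' k t)"
        by (simp add: y_def z'_def add_divide_distrib)
      finally have "N (\<lambda>t. y k t + s * z' k t) \<le> 1" by (intro norm_le) auto
      with mem show ?thesis by (simp add: unit_ball_def)
    qed
    have conv: "(\<lambda>k. L (\<lambda>t. y k t + s * z' k t)) \<longlonglongrightarrow> L f" if L: "bounded_functional X N L" for s L
    proof -
      have add: "L (\<lambda>t. g t + h t) = L g + L h" and scale: "L (\<lambda>t. c * g t) = c * L g"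
        if "g \<in> X" "h \<in> X" for g h c
        using L that by (auto simp: bounded_functional_def)
      have Lu: "L (u k) = L f - L (v k)" for k
        using add[OF fX scale_mem[OF v_mem], of "-1" k] scale[OF v_mem fX, of "-1" k]
        by (simp add: u_def[abs_def])
      have "L (\<lambda>t. y k t + s * z' k t) =
          1 / (1 + \<eta> k) * (1 / (1 + \<eta> k) * (L f - L (v k))) + s * (1 / (1 + \<eta> k) * L (z k))" for k
      proof -
        have "L (\<lambda>t. y k t + s * z' k t) = L (y k) + L (\<lambda>t. s * z' k t)"
          unfolding y_def by (intro add scale_mem u_mem z'_mem)
        also have "L (y k) = 1 / (1 + \<eta> k) * (1 / (1 + \<eta> k) * L (u k))"
          unfolding y_def by (simp only: scale[OF scale_mem[OF u_mem] fX] scale[OF u_mem fX])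
        also have "L (\<lambda>t. s * z' k t) = s * (1 / (1 + \<eta> k) * L (z k))"
          using scale[OF z'_mem fX, of s k] scale[OF z fX, of "1 / (1 + \<eta> k)" k]
          by (simp add: z'_def[abs_def])
        finally show ?thesis by (simp add: Lu)
      qed
      moreover have "(\<lambda>k. 1 / (1 + \<eta> k) * (1 / (1 + \<eta> k) * (L f - L (v k))) + s * (1 / (1 + \<eta> k) * L (z k)))
          \<longlonglongrightarrow> 1 * (1 * (L f - 0)) + s * (1 * 0)"
        by (intro tendsto_intros lim\<eta> Lv Lz L)
      ultimately show ?thesis by simp
    qed
    show "\<exists>y. \<forall>s\<in>{1, -1}. (\<forall>k. (\<lambda>t. y k t + s * z' k t) \<in> unit_ball X N) \<and>
        (\<forall>L. bounded_functional X N L \<longrightarrow> (\<lambda>k. L (\<lambda>t. y k t + s * z' k t)) \<longlonglongrightarrow> L f)"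
    proof (intro exI[of _ y] ballI conjI allI impI)
      fix s :: real and k assume "s \<in> {1, -1}"
      then show "(\<lambda>t. y k t + s * z' k t) \<in> unit_ball X N" by (intro ball) auto
    qed (rule conv)
  qed
  then show ?thesis
    using diameter_two_witness.SD2P diameter_two_witness.D2P diameter_two_witness.LD2P by blast
qed

end


section \<open>Orlicz functions and weighted rearrangements\<close>

locale orlicz =
  fixes \<phi> :: "real \<Rightarrow> real"
  assumes orlicz_function: "orlicz_function \<phi>" and nondegenerate: "nondegenerate \<phi>"
begin

lemma \<phi>_zero [simp]: "\<phi> 0 = 0"
  using orlicz_function by (simp add: orlicz_function_def)

lemma \<phi>_pos: "u > 0 \<Longrightarrow> \<phi> u > 0"
  using nondegenerate by (simp add: nondegenerate_def)

lemma \<phi>_nonneg: "u \<ge> 0 \<Longrightarrow> \<phi> u \<ge> 0"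
  using orlicz_function by (simp add: orlicz_function_def)

lemma \<phi>_convex:
  "0 \<le> a \<Longrightarrow> 0 \<le> b \<Longrightarrow> a + b = 1 \<Longrightarrow> 0 \<le> u \<Longrightarrow> 0 \<le> v \<Longrightarrow>
    \<phi> (a * u + b * v) \<le> a * \<phi> u + b * \<phi> v"
  using orlicz_function unfolding orlicz_function_def convex_on_def by simp

lemma \<phi>_scale: "0 \<le> a \<Longrightarrow> a \<le> 1 \<Longrightarrow> 0 \<le> u \<Longrightarrow> \<phi> (a * u) \<le> a * \<phi> u"
  using \<phi>_convex[of a "1 - a" u 0] by simp

text \<open>Nondegeneracy makes the comparison strict. Strictness is what allows level sets of
  \<open>\<phi> \<bar>f\<bar>\<close> to be read as level sets of
  \<open>\<bar>f\<bar>\<close>.\<close>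

lemma \<phi>_strict_mono:
  assumes "0 \<le> u" "u < v"
  shows "\<phi> u < \<phi> v"
proof -
  have "\<phi> (u / v * v) \<le> u / v * \<phi> v"
    using assms by (intro \<phi>_scale) auto
  also have "\<dots> < 1 * \<phi> v"
    using assms \<phi>_pos[of v] by (intro mult_strict_right_mono) auto
  finally show ?thesis using assms by simp
qed

lemma \<phi>_less_iff: "0 \<le> u \<Longrightarrow> 0 \<le> v \<Longrightarrow> \<phi> u < \<phi> v \<longleftrightarrow> u < v"
  using \<phi>_strict_mono by (metis less_asym linorder_neqE)

lemma \<phi>_mono: "0 \<le> u \<Longrightarrow> u \<le> v \<Longrightarrow> \<phi> u \<le> \<phi> v"
  using \<phi>_strict_mono[of u v] by (cases "u = v") auto

lemma \<phi>_le_linear: "0 \<le> u \<Longrightarrow> u \<le> 1 \<Longrightarrow> \<phi> u \<le> u * \<phi> 1"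
  using \<phi>_scale[of u 1] by simp

lemma \<phi>_ge_linear: "u \<ge> 1 \<Longrightarrow> \<phi> u \<ge> u * \<phi> 1"
  using \<phi>_scale[of "1 / u" u] by (simp add: field_simps)

lemma \<phi>_tendsto_zero: "(\<phi> \<longlongrightarrow> 0) (at_right 0)"
proof (rule tendsto_sandwich[OF _ _ tendsto_const])
  have ev: "\<forall>\<^sub>F u in at_right 0. 0 < u \<and> u < (1::real)"
    by (intro eventually_conj eventually_at_right_less eventually_at_rightI[of 0 1]) auto
  show "\<forall>\<^sub>F u in at_right 0. 0 \<le> \<phi> u"
    using ev by (rule eventually_mono) (auto intro: \<phi>_nonneg)
  show "\<forall>\<^sub>F u in at_right 0. \<phi> u \<le> u * \<phi> 1"
    using ev by (rule eventually_mono) (auto intro: \<phi>_le_linear)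
  have "((\<lambda>u. u * \<phi> 1) \<longlongrightarrow> 0 * \<phi> 1) (at_right 0)" by (intro tendsto_intros)
  then show "((\<lambda>u. u * \<phi> 1) \<longlongrightarrow> 0) (at_right 0)" by simp
qed

text \<open>Convexity gives continuity only in the open half line. At the endpoint 0, where a convex
  function may jump, the linear bound \<open>\<phi> u \<le> u * \<phi> 1\<close> excludes a
  jump.\<close>

lemma continuous_on_\<phi>: "continuous_on {0..} \<phi>"
proof -
  have "convex_on {0<..} \<phi>"
    using orlicz_function by (auto simp: orlicz_function_def intro: convex_on_subset)
  then have pos: "isCont \<phi> u" if "u > 0" for u
    using convex_on_continuous[of "{0<..}" \<phi>] that
    by (simp add: continuous_on_eq_continuous_at)
  have "(\<phi> \<longlongrightarrow> \<phi> u) (at u within {0..})" if "u \<ge> 0" for u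
  proof (cases "u = 0")
    case True
    have "at (0::real) within {0..} = at_right 0" by (rule at_within_Ici_at_right)
    with True \<phi>_tendsto_zero show ?thesis by simp
  next
    case False
    with pos[of u] that have "(\<phi> \<longlongrightarrow> \<phi> u) (at u)" by (simp add: isCont_def)
    then show ?thesis by (rule tendsto_within_subset) auto
  qed
  then show ?thesis by (simp add: continuous_on_def)
qed

lemma \<phi>_surj:
  assumes "y \<ge> 0"
  obtains u where "u \<ge> 0" "\<phi> u = y"
proof -
  \<comment> \<open>From 1 on, \<open>\<phi> u \<ge> u * \<phi> 1\<close>, so this \<open>b\<close>
    satisfies \<open>\<phi> b \<ge> y\<close>.\<close>
  define b where "b = 1 + y / \<phi> 1"
  have "\<phi> 1 > 0" by (simp add: \<phi>_pos)
  then have b: "b \<ge> 1" "y \<le> b * \<phi> 1" using assms by (auto simp: b_def field_simps)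
  have "\<exists>u\<ge>0. u \<le> b \<and> \<phi> u = y"
    using b assms \<phi>_ge_linear[of b]
    by (intro IVT' continuous_on_subset[OF continuous_on_\<phi>]) auto
  then show ?thesis using that by blast
qed

lemma measurable_\<phi>_abs [measurable]:
  assumes [measurable]: "f \<in> borel_measurable M"
  shows "(\<lambda>t. \<phi> \<bar>f t\<bar>) \<in> borel_measurable M"
proof -
  \<comment> \<open>The values of \<phi> at negative arguments are arbitrary; \<open>max 0\<close>
    gives a function monotone on the whole line.\<close>
  have "mono (\<lambda>u. \<phi> (max 0 u))" by (intro monoI \<phi>_mono) auto
  from borel_measurable_mono[OF this] have [measurable]: "(\<lambda>u. \<phi> (max 0 u)) \<in> borel_measurable borel" .
  have "(\<lambda>t. \<phi> (max 0 \<bar>f t\<bar>)) \<in> borel_measurable M" by measurable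
  then show ?thesis by simp
qed

section \<open>Failure of doubling as unbounded gain under small dilations\<close>

lemma iterated_dilation:
  assumes "K \<ge> 0" "\<And>j. j < m \<Longrightarrow> \<phi> ((1 + \<delta>) * ((1 + \<delta>) ^ j * u)) \<le> K * \<phi> ((1 + \<delta>) ^ j * u)"
  shows "\<phi> ((1 + \<delta>) ^ m * u) \<le> K ^ m * \<phi> u"
  using assms(2)
proof (induction m)
  case (Suc m)
  have "\<phi> ((1 + \<delta>) ^ Suc m * u) \<le> K * \<phi> ((1 + \<delta>) ^ m * u)"
    using Suc.prems[of m] by (simp add: mult.assoc)
  also have "\<dots> \<le> K * (K ^ m * \<phi> u)"
    using Suc assms(1) by (intro mult_left_mono) auto
  finally show ?case by (simp add: mult.assoc)
qed simp

text \<open>If each dilation by \<open>1 + \<delta>\<close> along the orbit of \<open>u\<close>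
  costs at most the factor \<open>K\<close>, then \<open>m\<close> of them reach 2 at the cost
  \<open>K ^ m\<close>. The maximum with 3 meets the requirement of a constant above 2 in the
  doubling conditions.\<close>

lemma doubling_bound:
  assumes "K \<ge> 0" "u \<ge> 0" "2 \<le> (1 + \<delta>) ^ m"
    and "\<And>j. j < m \<Longrightarrow> \<phi> ((1 + \<delta>) * ((1 + \<delta>) ^ j * u)) \<le> K * \<phi> ((1 + \<delta>) ^ j * u)"
  shows "\<phi> (2 * u) \<le> max 3 (K ^ m) * \<phi> u"
proof -
  have "\<phi> (2 * u) \<le> \<phi> ((1 + \<delta>) ^ m * u)"
    using assms by (intro \<phi>_mono mult_right_mono) auto
  also have "\<dots> \<le> K ^ m * \<phi> u"
    using assms by (intro iterated_dilation) auto
  also have "\<dots> \<le> max 3 (K ^ m) * \<phi> u"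
    using assms by (intro mult_right_mono \<phi>_nonneg) auto
  finally show ?thesis .
qed

lemma not_Delta2_zero_dilation:
  assumes "\<not> Delta2_zero \<phi>" "\<delta> > 0" "K \<ge> 0" "u\<^sub>0 > 0"
  obtains u where "0 < u" "u \<le> u\<^sub>0" "\<phi> ((1 + \<delta>) * u) > K * \<phi> u"
proof -
  have "\<exists>u>0. u \<le> u\<^sub>0 \<and> \<phi> ((1 + \<delta>) * u) > K * \<phi> u"
  proof (rule ccontr)
    assume neg: "\<not> ?thesis"
    have le: "\<phi> ((1 + \<delta>) * u) \<le> K * \<phi> u" if "0 \<le> u" "u \<le> u\<^sub>0" for u
      using neg that by (cases "u = 0") (auto simp: not_less)
    obtain m where m: "2 < (1 + \<delta>) ^ m" using real_arch_pow[of "1 + \<delta>" 2] assms by auto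
    have pos: "(1 + \<delta>) ^ j > 0" for j using assms by simp
    \<comment> \<open>Starting below \<open>u\<^sub>0 / (1 + \<delta>) ^ m\<close> keeps all
      iterates below \<open>u\<^sub>0\<close>.\<close>
    have "\<phi> (2 * u) \<le> max 3 (K ^ m) * \<phi> u" if u: "0 \<le> u" "u \<le> u\<^sub>0 / (1 + \<delta>) ^ m" for u
    proof (rule doubling_bound)
      fix j assume j: "j < m"
      have "(1 + \<delta>) ^ j * u \<le> (1 + \<delta>) ^ m * u"
        using j u assms by (intro mult_right_mono power_increasing) auto
      also have "\<dots> \<le> u\<^sub>0" using u pos[of m] by (simp add: field_simps)
      finally show "\<phi> ((1 + \<delta>) * ((1 + \<delta>) ^ j * u)) \<le> K * \<phi> ((1 + \<delta>) ^ j * u)"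
        using u pos[of j] by (intro le) auto
    qed (use m u assms in auto)
    then have "Delta2_zero \<phi>"
      unfolding Delta2_zero_def using pos[of m] assms
      by (intro exI[of _ "max 3 (K ^ m)"] conjI exI[of _ "u\<^sub>0 / (1 + \<delta>) ^ m"]) auto
    with assms show False by simp
  qed
  then show ?thesis using that by blast
qed

lemma not_Delta2_infinity_dilation:
  assumes "\<not> Delta2_infinity \<phi>" "\<delta> > 0" "K \<ge> 0" "u\<^sub>0 > 0"
  obtains u where "u \<ge> u\<^sub>0" "\<phi> ((1 + \<delta>) * u) > K * \<phi> u"
proof -
  have "\<exists>u\<ge>u\<^sub>0. \<phi> ((1 + \<delta>) * u) > K * \<phi> u"
  proof (rule ccontr)
    assume neg: "\<not> ?thesis"
    have le: "\<phi> ((1 + \<delta>) * u) \<le> K * \<phi> u" if "u\<^sub>0 \<le> u" for u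
      using neg that by (auto simp: not_less)
    obtain m where m: "2 < (1 + \<delta>) ^ m" using real_arch_pow[of "1 + \<delta>" 2] assms by auto
    \<comment> \<open>Here the iterates only move away from 0, so the threshold
      \<open>u\<^sub>0\<close> can be kept.\<close>
    have "\<phi> (2 * u) \<le> max 3 (K ^ m) * \<phi> u" if u: "u\<^sub>0 \<le> u" for u
    proof (rule doubling_bound)
      fix j assume j: "j < m"
      have "1 * u \<le> (1 + \<delta>) ^ j * u"
        using u assms by (intro mult_right_mono one_le_power) auto
      then show "\<phi> ((1 + \<delta>) * ((1 + \<delta>) ^ j * u)) \<le> K * \<phi> ((1 + \<delta>) ^ j * u)"
        using u by (intro le) auto
    qed (use m u assms in auto)
    then have "Delta2_infinity \<phi>"
      unfolding Delta2_infinity_def using assms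
      by (intro exI[of _ "max 3 (K ^ m)"] conjI exI[of _ "u\<^sub>0"]) auto
    with assms show False by simp
  qed
  then show ?thesis using that by blast
qed

abbreviation "\<Phi> \<equiv> extend_infinity \<phi>"

lemma \<Phi>_mono: "x \<le> y \<Longrightarrow> \<Phi> x \<le> \<Phi> y"
  by (cases x; cases y)
    (auto simp: extend_infinity_def \<phi>_mono \<phi>_nonneg ennreal_le_iff top_unique intro!: ennreal_leI)

lemma less_\<Phi>_iff: "s \<ge> 0 \<Longrightarrow> ennreal (\<phi> s) < \<Phi> y \<longleftrightarrow> ennreal s < y"
  by (cases y) (auto simp: extend_infinity_def \<phi>_less_iff \<phi>_nonneg ennreal_less_iff)

end

section \<open>Layer cake for extended numbers, and distribution functions\<close>

lemma emeasure_lborel_Ici: "emeasure lborel {0::real..} = top"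
proof -
  have "of_nat n \<le> emeasure lborel {0::real..}" for n
  proof -
    have "emeasure lborel {0..real n} \<le> emeasure lborel {0::real..}" by (intro emeasure_mono) auto
    then show ?thesis by (simp add: ennreal_of_nat_eq_real_of_nat)
  qed
  then have "(SUP n. of_nat n :: ennreal) \<le> emeasure lborel {0::real..}" by (intro SUP_least)
  then show ?thesis by (simp add: ennreal_SUP_of_nat_eq_top top_unique)
qed

text \<open>The layer-cake formula for a single number. The value \<open>\<infinity>\<close> is
  included because rearrangements can be infinite.\<close>

lemma ennreal_eq_layers:
  fixes y :: ennreal
  shows "y = (\<integral>\<^sup>+ s. indicator {s. 0 \<le> s \<and> ennreal s < y} s \<partial>lborel)"
proof (cases y)
  case (real r)
  then have "{s. 0 \<le> s \<and> ennreal s < y} = {0..<r}" by (auto simp: ennreal_less_iff)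
  with real show ?thesis by simp
next
  case top
  then have "{s. 0 \<le> s \<and> ennreal s < y} = {0..}" by auto
  then show ?thesis using top by (simp add: emeasure_lborel_Ici)
qed

text \<open>Rearrangements will be accessible through strict comparison with real thresholds; this
  shows that such comparisons determine them.\<close>

lemma ennreal_eqI_layers:
  fixes x y :: ennreal
  assumes "\<And>s. 0 \<le> s \<Longrightarrow> ennreal s < x \<longleftrightarrow> ennreal s < y"
  shows "x = y"
proof -
  have "{s. 0 \<le> s \<and> ennreal s < x} = {s. 0 \<le> s \<and> ennreal s < y}" using assms by auto
  then show ?thesis using ennreal_eq_layers[of x] ennreal_eq_layers[of y] by simp
qed

lemma distribution_function_antimono:
  assumes [measurable]: "f \<in> borel_measurable M" and "s \<le> s'"
  shows "distribution_function M f s' \<le> distribution_function M f s"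
  unfolding distribution_function_def using assms(2) by (intro emeasure_mono) auto

text \<open>The set where \<open>\<bar>f\<bar> > s\<close> is the increasing union of those with
  threshold \<open>s + 1 / Suc n\<close>, so continuity from below keeps the measure above
  \<open>x\<close> for one of them.\<close>

lemma distribution_function_right_continuous:
  assumes [measurable]: "f \<in> borel_measurable M" and "x < distribution_function M f s"
  obtains s' where "s < s'" "x < distribution_function M f s'"
proof -
  let ?A = "\<lambda>n::nat. {t \<in> space M. \<bar>f t\<bar> > s + 1 / Suc n}"
  have "incseq ?A"
    by (intro incseq_SucI) (auto elim!: le_less_trans[rotated] simp: frac_le)
  then have "(SUP n. emeasure M (?A n)) = emeasure M (\<Union>n. ?A n)"
    by (intro SUP_emeasure_incseq) auto
  also have "(\<Union>n. ?A n) = {t \<in> space M. \<bar>f t\<bar> > s}"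
  proof (intro equalityI subsetI)
    fix t assume "t \<in> {t \<in> space M. \<bar>f t\<bar> > s}"
    then have t: "t \<in> space M" "0 < \<bar>f t\<bar> - s" by auto
    then obtain n where "inverse (real (Suc n)) < \<bar>f t\<bar> - s" using reals_Archimedean by blast
    with t show "t \<in> (\<Union>n. ?A n)" by (auto simp: inverse_eq_divide algebra_simps intro!: exI[of _ n])
  next
    fix t assume "t \<in> (\<Union>n. ?A n)"
    then obtain n :: nat where "t \<in> space M" "\<bar>f t\<bar> > s + 1 / Suc n" by auto
    moreover have "1 / real (Suc n) > 0" by simp
    ultimately have "t \<in> space M" "\<bar>f t\<bar> > s" by linarith+
    then show "t \<in> {t \<in> space M. \<bar>f t\<bar> > s}" by simp
  qed
  finally have "x < (SUP n. emeasure M (?A n))" using assms(2) by (simp add: distribution_function_def)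
  then obtain n where "x < emeasure M (?A n)" by (auto simp: less_SUP_iff)
  then show ?thesis by (intro that[of "s + 1 / Suc n"]) (auto simp: distribution_function_def)
qed

section \<open>Weighted rearrangements over an abstract space of positions\<close>

text \<open>\<open>M\<close> carries the functions, \<open>T\<close> the rearranged positions, and
  \<open>\<tau> t\<close> measures what lies before \<open>t\<close>. The instances are the interval
  with \<open>\<tau> = ennreal\<close> and the naturals with \<open>\<tau> = of_nat\<close>.
  \<open>nested\<close> encodes a decreasing weight without an order on \<open>T\<close>; it is
  asked only for values \<open>emeasure M B\<close>, since segments of other lengths need not
  exist.\<close>

locale rearranged = orlicz \<phi> for \<phi> +
  fixes M :: "'a measure" and T :: "'b measure" and \<tau> :: "'b \<Rightarrow> ennreal" and w :: "'b \<Rightarrow> real"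
  assumes sigma_finite_M: "sigma_finite_measure M" and sigma_finite_T: "sigma_finite_measure T"
    and \<tau>_measurable [measurable]: "\<tau> \<in> borel_measurable T"
    and w_measurable [measurable]: "w \<in> borel_measurable T"
    and nested: "\<And>B r. B \<in> sets M \<Longrightarrow> r \<ge> 0 \<Longrightarrow>
      emeasure T {t \<in> space T. w t > r \<and> \<tau> t < emeasure M B} =
      min (emeasure T {t \<in> space T. w t > r}) (emeasure M B)"
begin

sublocale M: sigma_finite_measure M by (rule sigma_finite_M)
sublocale T: sigma_finite_measure T by (rule sigma_finite_T)

abbreviation "D \<equiv> distribution_function M"

definition rearr :: "('a \<Rightarrow> real) \<Rightarrow> 'b \<Rightarrow> ennreal" where
  "rearr f t = Inf {ennreal s | s. s > 0 \<and> D f s \<le> \<tau> t}"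

definition \<rho> :: "('a \<Rightarrow> real) \<Rightarrow> ennreal" where
  "\<rho> f = (\<integral>\<^sup>+t. \<Phi> (rearr f t) * ennreal (w t) \<partial>T)"

definition W :: "ennreal \<Rightarrow> ennreal" where
  "W x = (\<integral>\<^sup>+t. indicator {t. \<tau> t < x} t * ennreal (w t) \<partial>T)"

definition level :: "real \<Rightarrow> ennreal" where
  "level r = emeasure T {t \<in> space T. w t > r}"

text \<open>Peetre's K-functional of \<open>f\<close> for the couple of L^1 and L^infinity at
  \<open>a\<close>, that is, the integral of the rearrangement of \<open>f\<close> over an initial
  segment of length \<open>a\<close> when there is one. Its form as a minimum over truncation levels
  yields sublinearity.\<close>

definition K :: "ennreal \<Rightarrow> ('a \<Rightarrow> real) \<Rightarrow> ennreal" where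
  "K a f = (\<integral>\<^sup>+s. indicator {0..} s * min a (D f s) \<partial>lborel)"

text \<open>Right continuity of the distribution function makes the strict inequalities correspond
  exactly. Layer integrals of the rearrangement become integrals of the distribution function
  through this equivalence.\<close>

lemma less_rearr_iff:
  assumes f [measurable]: "f \<in> borel_measurable M" and s: "s \<ge> 0"
  shows "ennreal s < rearr f t \<longleftrightarrow> \<tau> t < D f s"
proof
  assume "\<tau> t < D f s"
  then obtain s' where s': "s < s'" "\<tau> t < D f s'"
    by (rule distribution_function_right_continuous[OF f])
  have "ennreal s' \<le> rearr f t"
    unfolding rearr_def
  proof (intro Inf_greatest, clarify)
    fix r :: real assume r: "0 < r" "D f r \<le> \<tau> t"
    have "\<not> r \<le> s'" using distribution_function_antimono[OF f, of r s'] r s' by auto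
    then show "ennreal s' \<le> ennreal r" by (intro ennreal_leI) auto
  qed
  moreover have "ennreal s < ennreal s'" using s s' by (simp add: ennreal_less_iff)
  ultimately show "ennreal s < rearr f t" by auto
next
  assume less: "ennreal s < rearr f t"
  show "\<tau> t < D f s"
  proof (rule ccontr)
    assume neg: "\<not> \<tau> t < D f s"
    \<comment> \<open>For \<open>s = 0\<close> the threshold \<open>s\<close> itself is excluded
      from the infimum, so it is approached from above.\<close>
    have "rearr f t \<le> ennreal s + ennreal e" if "e > 0" for e
    proof -
      have "D f (s + e) \<le> \<tau> t"
        using distribution_function_antimono[OF f, of s "s + e"] neg that by auto
      then have "rearr f t \<le> ennreal (s + e)"
        unfolding rearr_def using s that by (intro Inf_lower CollectI exI[of _ "s + e"]) simp
      then show ?thesis using s that by (simp add: ennreal_plus)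
    qed
    then have "rearr f t \<le> ennreal s" by (rule ennreal_le_epsilon)
    with less show False by simp
  qed
qed

lemma D_borel [measurable]:
  assumes [measurable]: "f \<in> borel_measurable M"
  shows "D f \<in> borel_measurable borel"
  unfolding distribution_function_def by measurable

lemma rearr_measurable [measurable]:
  assumes [measurable]: "f \<in> borel_measurable M"
  shows "rearr f \<in> borel_measurable T"
proof -
  interpret TL: pair_sigma_finite T lborel ..
  have "rearr f = (\<lambda>t. \<integral>\<^sup>+ s. indicator {0..} s * indicator {x. \<tau> t < x} (D f s) \<partial>lborel)"
    by (rule ext, subst ennreal_eq_layers, intro nn_integral_cong)
      (auto simp: indicator_def less_rearr_iff)
  moreover have "\<dots> \<in> borel_measurable T" by measurable
  ultimately show ?thesis by simp
qed

lemma rearr_mono: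
  assumes "\<And>s. D f s \<le> D g s"
  shows "rearr f t \<le> rearr g t"
  unfolding rearr_def using assms order_trans by (intro Inf_superset_mono) blast

text \<open>Rearranging commutes with the increasing bijection \<phi> of the half line: every
  threshold is some \<open>\<phi> s\<close>, and \<open>\<phi> \<bar>f x\<bar> > \<phi> s\<close>
  means \<open>\<bar>f x\<bar> > s\<close>. This moves \<phi> inside, where its convexity can be
  used pointwise.\<close>

lemma \<Phi>_rearr:
  assumes [measurable]: "f \<in> borel_measurable M"
  shows "\<Phi> (rearr f t) = rearr (\<lambda>x. \<phi> \<bar>f x\<bar>) t"
proof (rule ennreal_eqI_layers)
  fix y :: real assume "0 \<le> y"
  then obtain s where s: "s \<ge> 0" "\<phi> s = y" by (rule \<phi>_surj)
  have "D (\<lambda>x. \<phi> \<bar>f x\<bar>) (\<phi> s) = D f s"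
    using s(1) by (simp add: distribution_function_def \<phi>_nonneg \<phi>_less_iff)
  then show "ennreal y < \<Phi> (rearr f t) \<longleftrightarrow> ennreal y < rearr (\<lambda>x. \<phi> \<bar>f x\<bar>) t"
    unfolding s(2)[symmetric] using s(1) by (simp add: less_\<Phi>_iff less_rearr_iff \<phi>_nonneg)
qed

text \<open>Layers in the weight: by \<open>nested\<close>, each layer meets the segment in the
  smaller of the two measures.\<close>

lemma W_eq_level:
  assumes B: "B \<in> sets M"
  shows "W (emeasure M B) = (\<integral>\<^sup>+r. indicator {0..} r * min (level r) (emeasure M B) \<partial>lborel)"
proof -
  interpret TL: pair_sigma_finite T lborel ..
  let ?x = "emeasure M B"
  have "W ?x = (\<integral>\<^sup>+t. (\<integral>\<^sup>+r. indicator {t. \<tau> t < ?x} t * indicator {r. 0 \<le> r \<and> ennreal r < ennreal (w t)} r \<partial>lborel) \<partial>T)"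
    unfolding W_def by (subst ennreal_eq_layers[of "ennreal (w _)"], subst nn_integral_cmult) auto
  also have "\<dots> = (\<integral>\<^sup>+t. (\<integral>\<^sup>+r. indicator {0..} r * indicator {t \<in> space T. w t > r \<and> \<tau> t < ?x} t \<partial>lborel) \<partial>T)"
    by (intro nn_integral_cong) (auto simp: indicator_def ennreal_less_iff)
  also have "\<dots> = (\<integral>\<^sup>+r. (\<integral>\<^sup>+t. indicator {0..} r * indicator {t \<in> space T. w t > r \<and> \<tau> t < ?x} t \<partial>T) \<partial>lborel)"
    by (rule TL.Fubini'[symmetric]) measurable
  also have "\<dots> = (\<integral>\<^sup>+r. indicator {0..} r * min (level r) ?x \<partial>lborel)"
    unfolding level_def
    by (intro nn_integral_cong, subst nn_integral_cmult) (auto simp: indicator_def nested[OF B])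
  finally show ?thesis .
qed

lemma integral_rearr_eq_W:
  assumes [measurable]: "f \<in> borel_measurable M"
  shows "(\<integral>\<^sup>+t. rearr f t * ennreal (w t) \<partial>T) = (\<integral>\<^sup>+s. indicator {0..} s * W (D f s) \<partial>lborel)"
proof -
  interpret TL: pair_sigma_finite T lborel ..
  have "(\<integral>\<^sup>+t. rearr f t * ennreal (w t) \<partial>T) =
      (\<integral>\<^sup>+t. (\<integral>\<^sup>+s. indicator {s. 0 \<le> s \<and> ennreal s < rearr f t} s * ennreal (w t) \<partial>lborel) \<partial>T)"
    by (subst ennreal_eq_layers[of "rearr _ _"], subst nn_integral_multc) auto
  also have "\<dots> = (\<integral>\<^sup>+t. (\<integral>\<^sup>+s. indicator {0..} s * (indicator {x. \<tau> t < x} (D f s) * ennreal (w t)) \<partial>lborel) \<partial>T)"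
    by (intro nn_integral_cong) (auto simp: indicator_def less_rearr_iff)
  also have "\<dots> = (\<integral>\<^sup>+s. (\<integral>\<^sup>+t. indicator {0..} s * (indicator {x. \<tau> t < x} (D f s) * ennreal (w t)) \<partial>T) \<partial>lborel)"
    by (rule TL.Fubini'[symmetric]) measurable
  also have "\<dots> = (\<integral>\<^sup>+s. indicator {0..} s * W (D f s) \<partial>lborel)"
    unfolding W_def
    by (intro nn_integral_cong, subst nn_integral_cmult) (auto simp: indicator_def)
  finally show ?thesis .
qed

text \<open>With layers in both the function and the weight, the weight survives only in the numbers
  \<open>level r\<close>. Sublinearity in \<open>f\<close> can then be proved for each
  \<open>K a\<close> separately and integrated.\<close>

lemma integral_rearr_eq_K:
  assumes [measurable]: "f \<in> borel_measurable M"
  shows "(\<integral>\<^sup>+t. rearr f t * ennreal (w t) \<partial>T) = (\<integral>\<^sup>+r. indicator {0..} r * K (level r) f \<partial>lborel)"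
proof -
  have [measurable]: "level \<in> borel_measurable borel" unfolding level_def by measurable
  have "W (D f s) = (\<integral>\<^sup>+r. indicator {0..} r * min (level r) (D f s) \<partial>lborel)" for s
    unfolding distribution_function_def by (rule W_eq_level) measurable
  then have "(\<integral>\<^sup>+t. rearr f t * ennreal (w t) \<partial>T) =
      (\<integral>\<^sup>+s. (\<integral>\<^sup>+r. indicator {0..} s * (indicator {0..} r * min (level r) (D f s)) \<partial>lborel) \<partial>lborel)"
    unfolding integral_rearr_eq_W[OF assms] by (subst nn_integral_cmult) auto
  also have "\<dots> = (\<integral>\<^sup>+r. (\<integral>\<^sup>+s. indicator {0..} s * (indicator {0..} r * min (level r) (D f s)) \<partial>lborel) \<partial>lborel)"
    by (rule lborel_pair.Fubini') measurable
  also have "\<dots> = (\<integral>\<^sup>+r. indicator {0..} r * K (level r) f \<partial>lborel)"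
    unfolding K_def by (subst nn_integral_cmult[symmetric]) (auto simp: ac_simps)
  finally show ?thesis .
qed

text \<open>Since \<open>ennreal\<close> sends negative reals to 0, the integrand is the positive
  part of \<open>\<bar>f x\<bar> - c\<close>.\<close>

abbreviation "excess f c \<equiv> \<integral>\<^sup>+x. ennreal (\<bar>f x\<bar> - c) \<partial>M"

lemma integral_D_eq_excess:
  assumes [measurable]: "f \<in> borel_measurable M"
  shows "(\<integral>\<^sup>+s. indicator {c..} s * D f s \<partial>lborel) = excess f c"
proof -
  interpret MB: pair_sigma_finite M lborel ..
  have "(\<integral>\<^sup>+s. indicator {c..} s * D f s \<partial>lborel) =
      (\<integral>\<^sup>+s. (\<integral>\<^sup>+x. indicator {c..} s * indicator {x \<in> space M. \<bar>f x\<bar> > s} x \<partial>M) \<partial>lborel)"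
    unfolding distribution_function_def
    by (intro nn_integral_cong, subst nn_integral_cmult) auto
  also have "\<dots> = (\<integral>\<^sup>+x. (\<integral>\<^sup>+s. indicator {c..} s * indicator {x \<in> space M. \<bar>f x\<bar> > s} x \<partial>lborel) \<partial>M)"
    by (rule MB.Fubini') measurable
  also have "\<dots> = (\<integral>\<^sup>+x. (\<integral>\<^sup>+s. indicator {c..<\<bar>f x\<bar>} s \<partial>lborel) \<partial>M)"
    by (intro nn_integral_cong) (auto simp: indicator_def)
  also have "\<dots> = excess f c"
  proof (intro nn_integral_cong)
    fix x
    have "emeasure lborel {c..<\<bar>f x\<bar>} = ennreal (\<bar>f x\<bar> - c)"
      by (cases "c \<le> \<bar>f x\<bar>") (auto simp: ennreal_neg)
    then show "(\<integral>\<^sup>+s. indicator {c..<\<bar>f x\<bar>} s \<partial>lborel) = ennreal (\<bar>f x\<bar> - c)" by simp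
  qed
  finally show ?thesis .
qed

lemma split_integral:
  assumes [measurable]: "f \<in> borel_measurable M" and "c \<ge> 0"
  shows "(\<integral>\<^sup>+s. indicator {0..<c} s * a + indicator {c..} s * D f s \<partial>lborel) = a * ennreal c + excess f c"
proof -
  have "(\<integral>\<^sup>+s. indicator {0..<c} s * a \<partial>lborel) = a * ennreal c"
    using assms(2) by (subst nn_integral_multc) (simp_all add: mult.commute)
  then show ?thesis
    by (subst nn_integral_add) (simp_all only: integral_D_eq_excess[OF assms(1)], measurable)
qed

lemma K_le:
  assumes [measurable]: "f \<in> borel_measurable M" and c: "c \<ge> 0"
  shows "K a f \<le> a * ennreal c + excess f c"
  unfolding K_def split_integral[OF assms, symmetric]
  using c by (intro nn_integral_mono) (auto simp: indicator_def)

text \<open>The infimum over \<open>c\<close> of the bound in \<open>K_le\<close> is attained at the value of the decreasing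
  rearrangement of \<open>f\<close> at \<open>a\<close>.\<close>

lemma K_attained:
  assumes f [measurable]: "f \<in> borel_measurable M" and "a \<noteq> 0" "K a f \<noteq> \<infinity>"
  obtains c where "c \<ge> 0" "a * ennreal c + excess f c \<le> K a f"
proof -
  define S where "S = {s. s \<ge> 0 \<and> D f s \<le> a}"
  have "S \<noteq> {}"
  proof
    \<comment> \<open>Without such a level the minimum is constantly \<open>a\<close>, and the
      integral diverges because \<open>a\<close> is not 0.\<close>
    assume "S = {}"
    then have "min a (D f s) = a" if "s \<ge> 0" for s
    proof -
      have "s \<notin> S" using \<open>S = {}\<close> by simp
      with that show ?thesis by (simp add: S_def)
    qed
    then have "K a f = (\<integral>\<^sup>+s. a * indicator {0::real..} s \<partial>lborel)"
      unfolding K_def by (intro nn_integral_cong) (auto simp: indicator_def)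
    also have "\<dots> = a * top"
      by (subst nn_integral_cmult_indicator) (auto simp: emeasure_lborel_Ici)
    finally show False using assms by (simp add: ennreal_mult_top)
  qed
  moreover have bdd: "bdd_below S" by (intro bdd_belowI[of _ 0]) (auto simp: S_def)
  ultimately have c0: "Inf S \<ge> 0" by (intro cInf_greatest) (auto simp: S_def)
  have "(\<integral>\<^sup>+s. indicator {0..<Inf S} s * a + indicator {Inf S..} s * D f s \<partial>lborel) \<le> K a f"
    unfolding K_def
  proof (rule nn_integral_mono_AE)
    \<comment> \<open>Whether \<open>Inf S\<close> belongs to \<open>S\<close> can be left open,
      since a single level has measure 0.\<close>
    have "AE s in lborel. s \<noteq> Inf S" by (rule AE_lborel_singleton)
    then show "AE s in lborel. indicator {0..<Inf S} s * a + indicator {Inf S..} s * D f s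
        \<le> indicator {0..} s * min a (D f s)"
    proof (rule eventually_mono)
      fix s assume ne: "s \<noteq> Inf S"
      have "a \<le> D f s" if "0 \<le> s" "s < Inf S"
      proof -
        have "s \<notin> S" using cInf_lower[OF _ bdd, of s] that by auto
        with that show ?thesis by (simp add: S_def)
      qed
      moreover have "D f s \<le> a" if less: "Inf S < s"
      proof -
        obtain s' where "s' \<in> S" "s' < s" using cInf_lessD[OF \<open>S \<noteq> {}\<close> less] by auto
        then show ?thesis using distribution_function_antimono[OF f, of s' s] by (auto simp: S_def)
      qed
      ultimately show "indicator {0..<Inf S} s * a + indicator {Inf S..} s * D f s
          \<le> indicator {0..} s * min a (D f s)"
        using ne c0 by (auto simp: indicator_def min_def)
    qed
  qed
  with c0 that[OF c0] show ?thesis by (simp add: split_integral)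
qed

lemma K_zero: "K 0 f = 0"
  by (simp add: K_def)

text \<open>Take optimal levels \<open>c\<close> for \<open>f\<close> and \<open>c'\<close> for
  \<open>g\<close>; then \<open>b * c + b' * c'\<close> is a competitor for \<open>h\<close>,
  because the positive part is sublinear. Positivity of \<open>b\<close> and \<open>b'\<close> makes
  the right side infinite when one of the two terms is.\<close>

lemma K_sublinear:
  assumes [measurable]: "f \<in> borel_measurable M" "g \<in> borel_measurable M" "h \<in> borel_measurable M"
    and pos: "b > 0" "b' > 0" and le: "\<And>x. \<bar>h x\<bar> \<le> b * \<bar>f x\<bar> + b' * \<bar>g x\<bar>"
  shows "K a h \<le> ennreal b * K a f + ennreal b' * K a g"
proof (cases "a = 0 \<or> K a f = \<infinity> \<or> K a g = \<infinity>")
  case True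
  with pos show ?thesis by (auto simp: K_zero ennreal_mult_top)
next
  case False
  obtain c where c: "c \<ge> 0" "a * ennreal c + excess f c \<le> K a f"
    using K_attained[of f a] False by auto
  obtain c' where c': "c' \<ge> 0" "a * ennreal c' + excess g c' \<le> K a g"
    using K_attained[of g a] False by auto
  have "excess h (b * c + b' * c') \<le> (\<integral>\<^sup>+x. ennreal b * ennreal (\<bar>f x\<bar> - c) + ennreal b' * ennreal (\<bar>g x\<bar> - c') \<partial>M)"
  proof (intro nn_integral_mono)
    fix x
    have "\<bar>h x\<bar> - (b * c + b' * c') \<le> b * (\<bar>f x\<bar> - c) + b' * (\<bar>g x\<bar> - c')"
      using le[of x] by (simp add: algebra_simps)
    also have "\<dots> \<le> b * max 0 (\<bar>f x\<bar> - c) + b' * max 0 (\<bar>g x\<bar> - c')"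
      using pos by (intro add_mono mult_left_mono) auto
    finally have "ennreal (\<bar>h x\<bar> - (b * c + b' * c')) \<le>
        ennreal (b * max 0 (\<bar>f x\<bar> - c) + b' * max 0 (\<bar>g x\<bar> - c'))"
      by (rule ennreal_leI)
    also have "\<dots> = ennreal b * ennreal (\<bar>f x\<bar> - c) + ennreal b' * ennreal (\<bar>g x\<bar> - c')"
    proof -
      have "ennreal (max 0 r) = ennreal r" for r by (simp add: max_def ennreal_neg)
      then show ?thesis using pos by (simp add: ennreal_plus ennreal_mult)
    qed
    finally show "ennreal (\<bar>h x\<bar> - (b * c + b' * c')) \<le>
        ennreal b * ennreal (\<bar>f x\<bar> - c) + ennreal b' * ennreal (\<bar>g x\<bar> - c')" .
  qed
  also have "\<dots> = ennreal b * excess f c + ennreal b' * excess g c'"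
    by (simp add: nn_integral_add nn_integral_cmult)
  finally have ex: "excess h (b * c + b' * c') \<le> ennreal b * excess f c + ennreal b' * excess g c'" .
  have "K a h \<le> a * ennreal (b * c + b' * c') + excess h (b * c + b' * c')"
    using pos c c' by (intro K_le) auto
  also have "\<dots> \<le> a * ennreal (b * c + b' * c') + (ennreal b * excess f c + ennreal b' * excess g c')"
    by (intro add_left_mono ex)
  also have "\<dots> = ennreal b * (a * ennreal c + excess f c) + ennreal b' * (a * ennreal c' + excess g c')"
    using pos c c' by (simp add: ennreal_plus ennreal_mult distrib_left ac_simps)
  also have "\<dots> \<le> ennreal b * K a f + ennreal b' * K a g"
    using c c' by (intro add_mono mult_left_mono) auto
  finally show ?thesis .
qed

lemma K_measurable [measurable]:
  assumes [measurable]: "f \<in> borel_measurable M"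
  shows "(\<lambda>r. K (level r) f) \<in> borel_measurable borel"
proof -
  have [measurable]: "level \<in> borel_measurable borel" unfolding level_def by measurable
  show ?thesis unfolding K_def by measurable
qed

lemma \<rho>_eq_rearr:
  assumes "f \<in> borel_measurable M"
  shows "\<rho> f = (\<integral>\<^sup>+t. rearr (\<lambda>x. \<phi> \<bar>f x\<bar>) t * ennreal (w t) \<partial>T)"
  by (simp add: \<rho>_def \<Phi>_rearr[OF assms])

text \<open>One inequality for two uses: coefficients with sum 1 give convexity, and coefficients 1
  and 1 give subadditivity on disjoint supports, where at each point one of the two terms
  vanishes.\<close>

lemma \<rho>_sublinear:
  assumes [measurable]: "f \<in> borel_measurable M" "g \<in> borel_measurable M" "h \<in> borel_measurable M"
    and pos: "b > 0" "b' > 0" and le: "\<And>x. \<phi> \<bar>h x\<bar> \<le> b * \<phi> \<bar>f x\<bar> + b' * \<phi> \<bar>g x\<bar>"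
  shows "\<rho> h \<le> ennreal b * \<rho> f + ennreal b' * \<rho> g"
proof -
  have "\<rho> h = (\<integral>\<^sup>+r. indicator {0..} r * K (level r) (\<lambda>x. \<phi> \<bar>h x\<bar>) \<partial>lborel)"
    by (simp add: \<rho>_eq_rearr integral_rearr_eq_K)
  also have "\<dots> \<le> (\<integral>\<^sup>+r. ennreal b * (indicator {0..} r * K (level r) (\<lambda>x. \<phi> \<bar>f x\<bar>))
      + ennreal b' * (indicator {0..} r * K (level r) (\<lambda>x. \<phi> \<bar>g x\<bar>)) \<partial>lborel)"
  proof (intro nn_integral_mono)
    fix r :: real
    have "K (level r) (\<lambda>x. \<phi> \<bar>h x\<bar>) \<le>
        ennreal b * K (level r) (\<lambda>x. \<phi> \<bar>f x\<bar>) + ennreal b' * K (level r) (\<lambda>x. \<phi> \<bar>g x\<bar>)"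
      using pos le by (intro K_sublinear) (auto simp: \<phi>_nonneg)
    then show "indicator {0..} r * K (level r) (\<lambda>x. \<phi> \<bar>h x\<bar>) \<le>
        ennreal b * (indicator {0..} r * K (level r) (\<lambda>x. \<phi> \<bar>f x\<bar>))
        + ennreal b' * (indicator {0..} r * K (level r) (\<lambda>x. \<phi> \<bar>g x\<bar>))"
      by (simp add: indicator_def)
  qed
  also have "\<dots> = ennreal b * \<rho> f + ennreal b' * \<rho> g"
    by (simp add: nn_integral_add nn_integral_cmult \<rho>_eq_rearr integral_rearr_eq_K)
  finally show ?thesis .
qed

lemma \<rho>_mono:
  assumes [measurable]: "f \<in> borel_measurable M" "g \<in> borel_measurable M"
    and le: "AE t in M. \<bar>f t\<bar> \<le> \<bar>g t\<bar>"
  shows "\<rho> f \<le> \<rho> g"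
proof -
  have "D f s \<le> D g s" for s
    unfolding distribution_function_def
    by (intro emeasure_mono_AE eventually_mono[OF le]) auto
  then show ?thesis
    unfolding \<rho>_def by (intro nn_integral_mono mult_right_mono \<Phi>_mono rearr_mono) auto
qed

lemma W_zero: "W 0 = 0"
  by (simp add: W_def)

lemma W_mono: "x \<le> y \<Longrightarrow> W x \<le> W y"
  unfolding W_def by (intro nn_integral_mono) (auto simp: indicator_def)

text \<open>The distribution function is constant up to \<open>\<phi> u\<close> and 0 afterwards, so
  the layer integral collapses to a product. Only the measure of \<open>B\<close> matters, not its
  position.\<close>

lemma \<rho>_indicator:
  assumes u: "u \<ge> 0" and B [measurable]: "B \<in> sets M"
  shows "\<rho> (\<lambda>x. u * indicator B x) = ennreal (\<phi> u) * W (emeasure M B)"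
proof -
  have "D (\<lambda>x. \<phi> \<bar>u * indicator B x\<bar>) s = (if s < \<phi> u then emeasure M B else 0)" if "s \<ge> 0" for s
  proof -
    have "{x \<in> space M. \<bar>\<phi> \<bar>u * indicator B x\<bar>\<bar> > s} = (if s < \<phi> u then B else {})"
      using u that sets.sets_into_space[OF B] by (auto simp: indicator_def \<phi>_nonneg)
    then show ?thesis by (simp add: distribution_function_def)
  qed
  then have "\<rho> (\<lambda>x. u * indicator B x) = (\<integral>\<^sup>+s. indicator {0..<\<phi> u} s * W (emeasure M B) \<partial>lborel)"
    by (subst \<rho>_eq_rearr, simp, subst integral_rearr_eq_W, simp, intro nn_integral_cong)
      (auto simp: indicator_def W_zero)
  also have "\<dots> = ennreal (\<phi> u) * W (emeasure M B)"
    by (subst nn_integral_multc) (auto simp: \<phi>_nonneg u)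
  finally show ?thesis .
qed

sublocale modular M \<rho>
proof
  show "\<rho> f \<le> \<rho> g" if "f \<in> borel_measurable M" "g \<in> borel_measurable M" "AE t in M. \<bar>f t\<bar> \<le> \<bar>g t\<bar>" for f g
    by (rule \<rho>_mono[OF that])
  show "\<rho> (\<lambda>t. 0) = 0"
    using \<rho>_indicator[of 0 "{}"] by simp
  show "\<rho> (\<lambda>t. a * f t + b * g t) \<le> ennreal a * \<rho> f + ennreal b * \<rho> g"
    if [measurable]: "f \<in> borel_measurable M" "g \<in> borel_measurable M" and ab: "0 \<le> a" "0 \<le> b" "a + b = 1" for f g a b
  \<comment> \<open>\<open>\<rho>_sublinear\<close> asks for positive coefficients, so the endpoints
    are treated separately.\<close>
  proof (cases "a = 0 \<or> b = 0")
    case True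
    with ab show ?thesis by auto
  next
    case False
    show ?thesis
    proof (rule \<rho>_sublinear)
      fix x
      have "\<phi> \<bar>a * f x + b * g x\<bar> \<le> \<phi> (a * \<bar>f x\<bar> + b * \<bar>g x\<bar>)"
        using ab abs_triangle_ineq[of "a * f x" "b * g x"] by (intro \<phi>_mono) (auto simp: abs_mult)
      also have "\<dots> \<le> a * \<phi> \<bar>f x\<bar> + b * \<phi> \<bar>g x\<bar>" using ab by (intro \<phi>_convex) auto
      finally show "\<phi> \<bar>a * f x + b * g x\<bar> \<le> a * \<phi> \<bar>f x\<bar> + b * \<phi> \<bar>g x\<bar>" .
    qed (use ab False in auto)
  qed
  show "\<rho> (\<lambda>t. f t + g t) \<le> \<rho> f + \<rho> g"
    if [measurable]: "f \<in> borel_measurable M" "g \<in> borel_measurable M" and disj: "\<And>t. f t = 0 \<or> g t = 0" for f g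
  proof -
    have "\<phi> \<bar>f x + g x\<bar> \<le> 1 * \<phi> \<bar>f x\<bar> + 1 * \<phi> \<bar>g x\<bar>" for x
      using disj[of x] by (auto simp: \<phi>_nonneg)
    from \<rho>_sublinear[OF _ _ _ _ _ this] show ?thesis by simp
  qed
qed

end

section \<open>Order continuity of scaled indicators, and the block criterion\<close>

locale rearranged_small = rearranged +
  assumes W_small: "\<And>\<epsilon>. \<epsilon> > 0 \<Longrightarrow>
    \<exists>\<eta>>0. \<forall>B\<in>sets M. emeasure M B < ennreal \<eta> \<longrightarrow> W (emeasure M B) \<le> ennreal \<epsilon>"
begin

text \<open>Split \<open>B\<close> according to whether \<open>g n\<close> exceeds the low level
  \<open>e * \<sigma>\<close>. Where it does not, \<open>g n / e\<close> is at most
  \<open>\<sigma>\<close>, whose modular is small on all of \<open>B\<close>; where it does,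
  \<open>g n / e\<close> is at most \<open>u / e\<close> on a set of measure tending to 0, and
  \<open>W_small\<close> applies. Each part contributes at most 1/2.\<close>

lemma scaled_indicator_norm_tendsto_0:
  assumes u: "u > 0" and B [measurable]: "B \<in> sets M"
    and fin: "emeasure M B < \<infinity>" "W (emeasure M B) < \<infinity>"
    and g: "\<And>n::nat. g n \<in> \<Lambda>"
    and ae: "AE t in M. (\<forall>n. 0 \<le> g n t \<and> g n t \<le> \<bar>u * indicator B t\<bar>) \<and>
      decseq (\<lambda>n. g n t) \<and> (\<lambda>n. g n t) \<longlonglongrightarrow> 0"
  shows "(\<lambda>n. N (g n)) \<longlonglongrightarrow> 0"
proof (rule LIMSEQ_I)
  fix r :: real assume r: "r > 0"
  note [measurable] = space_measurable[OF g]
  define e where "e = r / 2"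
  have e: "e > 0" "e < r" using r by (auto simp: e_def)
  obtain V where V: "W (emeasure M B) = ennreal V" "V \<ge> 0"
    using fin(2) by (cases "W (emeasure M B)") auto
  \<comment> \<open>Chosen so that \<open>\<phi> \<sigma> * V \<le> 1 / 2\<close>: the linear bound,
    valid for \<open>\<sigma> \<le> 1\<close>, leaves
    \<open>\<phi> \<sigma> \<le> 1 / (1 + 2 * V)\<close>.\<close>
  define \<sigma> where "\<sigma> = 1 / ((1 + 2 * V) * (1 + \<phi> 1))"
  have "\<phi> 1 > 0" by (simp add: \<phi>_pos)
  then have "(1 + 2 * V) * (1 + \<phi> 1) \<ge> 1"
    using V(2) by (simp add: algebra_simps)
  then have \<sigma>: "\<sigma> > 0" "\<sigma> \<le> 1" by (auto simp: \<sigma>_def)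
  have "\<phi> \<sigma> \<le> \<sigma> * \<phi> 1" using \<sigma> by (intro \<phi>_le_linear) auto
  also have "\<dots> = 1 / (1 + 2 * V) * (\<phi> 1 / (1 + \<phi> 1))" by (simp add: \<sigma>_def)
  also have "\<dots> \<le> 1 / (1 + 2 * V) * 1"
    using \<open>\<phi> 1 > 0\<close> V(2) by (intro mult_left_mono) auto
  finally have "\<phi> \<sigma> * V \<le> 1 / (1 + 2 * V) * 1 * V"
    using V(2) by (rule mult_right_mono)
  also have "\<dots> \<le> 1 / 2" using V(2) by (simp add: field_simps)
  finally have \<phi>\<sigma>: "\<phi> \<sigma> * V \<le> 1 / 2" .
  have pos: "\<phi> (u / e) > 0" using u e by (intro \<phi>_pos) auto
  then obtain \<eta> where \<eta>: "\<eta> > 0" and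
    W_le: "\<And>B. B \<in> sets M \<Longrightarrow> emeasure M B < ennreal \<eta> \<Longrightarrow> W (emeasure M B) \<le> ennreal (1 / (2 * \<phi> (u / e)))"
    using W_small[of "1 / (2 * \<phi> (u / e))"] by auto
  define A where "A n = {t \<in> space M. g n t > e * \<sigma>}" for n
  have A [measurable]: "A n \<in> sets M" for n unfolding A_def by measurable
  have e\<sigma>: "e * \<sigma> > 0" using e \<sigma> by simp
  \<comment> \<open>Dominated convergence with the integrable majorant \<open>indicator B\<close>:
    almost every \<open>t\<close> eventually leaves \<open>A n\<close>, because \<open>g n t\<close>
    tends to 0.\<close>
  have "(\<lambda>n. \<integral>\<^sup>+t. indicator (A n) t \<partial>M) \<longlonglongrightarrow> (\<integral>\<^sup>+t. 0 \<partial>M)"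
  proof (rule nn_integral_dominated_convergence[where w = "indicator B"])
    show "AE t in M. indicator (A n) t \<le> (indicator B t :: ennreal)" for n
    proof (rule eventually_mono[OF ae], elim conjE)
      fix t assume "\<forall>n. 0 \<le> g n t \<and> g n t \<le> \<bar>u * indicator B t\<bar>"
      then have "g n t \<le> \<bar>u * indicator B t\<bar>" by blast
      then show "indicator (A n) t \<le> (indicator B t :: ennreal)"
        using e\<sigma> by (cases "t \<in> B") (auto simp: A_def indicator_def)
    qed
    show "AE t in M. (\<lambda>n. indicator (A n) t :: ennreal) \<longlonglongrightarrow> 0"
    proof (rule eventually_mono[OF ae], elim conjE)
      fix t assume "(\<lambda>n. g n t) \<longlonglongrightarrow> 0"
      then have "\<forall>\<^sub>F n in sequentially. g n t < e * \<sigma>" by (rule order_tendstoD(2)[OF _ e\<sigma>])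
      then have "\<forall>\<^sub>F n in sequentially. indicator (A n) t = (0::ennreal)"
        by (rule eventually_mono) (auto simp: A_def)
      then show "(\<lambda>n. indicator (A n) t :: ennreal) \<longlonglongrightarrow> 0" by (rule tendsto_eventually)
    qed
  qed (use fin in auto)
  then have "(\<lambda>n. emeasure M (A n)) \<longlonglongrightarrow> 0" by simp
  then have "\<forall>\<^sub>F n in sequentially. emeasure M (A n) < ennreal \<eta>"
    by (rule order_tendstoD(2)) (use \<eta> in simp)
  then obtain n\<^sub>0 where n\<^sub>0: "\<And>n. n \<ge> n\<^sub>0 \<Longrightarrow> emeasure M (A n) < ennreal \<eta>"
    by (auto simp: eventually_sequentially)
  have "norm (N (g n) - 0) < r" if n: "n \<ge> n\<^sub>0" for n
  proof -
    let ?p = "\<lambda>t. \<sigma> * indicator (B - A n) t" and ?q = "\<lambda>t. u / e * indicator (A n) t"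
    have "\<rho> (\<lambda>t. g n t / e) \<le> \<rho> (\<lambda>t. ?p t + ?q t)"
    proof (rule modular_mono)
      show "AE t in M. \<bar>g n t / e\<bar> \<le> \<bar>?p t + ?q t\<bar>"
      proof (rule AE_mp[OF ae AE_I2], rule impI)
        fix t assume "t \<in> space M" and t: "(\<forall>n. 0 \<le> g n t \<and> g n t \<le> \<bar>u * indicator B t\<bar>) \<and>
          decseq (\<lambda>n. g n t) \<and> (\<lambda>n. g n t) \<longlonglongrightarrow> 0"
        then have gt: "0 \<le> g n t" "g n t \<le> u * indicator B t" using u by (auto simp: abs_mult)
        show "\<bar>g n t / e\<bar> \<le> \<bar>?p t + ?q t\<bar>"
          using gt e \<sigma> u \<open>t \<in> space M\<close>
          by (cases "t \<in> A n"; cases "t \<in> B") (auto simp: A_def field_simps not_less)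
      qed
    qed auto
    also have "\<dots> \<le> \<rho> ?p + \<rho> ?q"
      by (rule modular_disjoint) (auto simp: indicator_def)
    also have "\<dots> \<le> ennreal (1 / 2) + ennreal (1 / 2)"
    proof (rule add_mono)
      have "\<rho> ?p = ennreal (\<phi> \<sigma>) * W (emeasure M (B - A n))"
        using \<sigma> by (intro \<rho>_indicator) auto
      also have "\<dots> \<le> ennreal (\<phi> \<sigma>) * ennreal V"
        unfolding V(1)[symmetric] by (intro mult_left_mono W_mono emeasure_mono) auto
      also have "\<dots> = ennreal (\<phi> \<sigma> * V)"
        using V \<sigma> by (intro ennreal_mult[symmetric] \<phi>_nonneg) auto
      also have "\<dots> \<le> ennreal (1 / 2)" using \<phi>\<sigma> by (rule ennreal_leI)
      finally show "\<rho> ?p \<le> ennreal (1 / 2)" .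
      have "\<rho> ?q = ennreal (\<phi> (u / e)) * W (emeasure M (A n))"
        using u e by (intro \<rho>_indicator) auto
      also have "\<dots> \<le> ennreal (\<phi> (u / e)) * ennreal (1 / (2 * \<phi> (u / e)))"
        by (intro mult_left_mono W_le n\<^sub>0 n) auto
      also have "\<dots> = ennreal (\<phi> (u / e) * (1 / (2 * \<phi> (u / e))))"
        using pos by (intro ennreal_mult[symmetric]) auto
      also have "\<phi> (u / e) * (1 / (2 * \<phi> (u / e))) = 1 / 2" using pos by simp
      finally show "\<rho> ?q \<le> ennreal (1 / 2)" .
    qed
    also have "\<dots> = ennreal (1 / 2 + 1 / 2)" by (intro ennreal_plus[symmetric]) auto
    finally have "\<rho> (\<lambda>t. g n t / e) \<le> 1" by simp
    then have "N (g n) \<le> e" by (rule norm_le[OF e(1)])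
    with norm_nonneg[OF g] e show ?thesis by simp
  qed
  then show "\<exists>n\<^sub>0. \<forall>n\<ge>n\<^sub>0. norm (N (g n) - 0) < r" by blast
qed

lemma scaled_indicator_mem_order_continuous_part:
  assumes u: "u > 0" and B [measurable]: "B \<in> sets M"
    and fin: "emeasure M B < \<infinity>" "W (emeasure M B) < \<infinity>"
  shows "(\<lambda>t. u * indicator B t) \<in> order_continuous_part M \<Lambda> N"
proof -
  have "\<rho> (\<lambda>t. u * indicator B t) < \<infinity>"
    using u fin by (simp add: \<rho>_indicator ennreal_mult_less_top)
  then have "(\<lambda>t. u * indicator B t) \<in> \<Lambda>" by (intro finite_modular_mem) auto
  moreover have "decseq (\<lambda>n. N (g n))" if "\<forall>n. g n \<in> \<Lambda>"
    "AE t in M. (\<forall>n. 0 \<le> g n t \<and> g n t \<le> \<bar>u * indicator B t\<bar>) \<and>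
      decseq (\<lambda>n. g n t) \<and> (\<lambda>n. g n t) \<longlonglongrightarrow> 0" for g :: "nat \<Rightarrow> 'a \<Rightarrow> real"
    using that(1) by (intro decseq_norm, blast, intro eventually_mono[OF that(2)]) auto
  ultimately show ?thesis
    using scaled_indicator_norm_tendsto_0[OF assms] unfolding order_continuous_part_def by auto
qed

theorem diameter_two_of_blocks:
  fixes u :: "nat \<Rightarrow> real" and B :: "nat \<Rightarrow> 'a set"
  assumes u: "\<And>k. u k > 0" and B: "disjoint_family B" "\<And>k. B k \<in> sets M"
    and fin: "\<And>k. emeasure M (B k) < \<infinity>"
    and small: "\<And>k. ennreal (\<phi> (u k)) * W (emeasure M (B k)) \<le> ennreal ((1/2) ^ Suc k)"
    and large: "\<And>k. ennreal (\<phi> ((1 + 1 / Suc k) * u k)) * W (emeasure M (B k)) > 1"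
    and X: "X = \<Lambda> \<or> X = order_continuous_part M \<Lambda> N"
  shows "SD2P X N \<and> D2P X N \<and> LD2P X N"
proof (rule diameter_two_properties)
  let ?z = "\<lambda>k t. u k * indicator (B k) t"
  have W_fin: "W (emeasure M (B k)) < \<infinity>" for k
  proof -
    have "ennreal (\<phi> (u k)) * W (emeasure M (B k)) < \<infinity>"
      using small[of k] by (rule le_less_trans) simp
    with \<phi>_pos[OF u[of k]] show ?thesis by (auto simp: ennreal_mult_less_top)
  qed
  show "ideal X" using X ideal_space ideal_order_continuous_part by auto
  have "order_continuous_part M \<Lambda> N \<subseteq> X" using X by (auto simp: order_continuous_part_def)
  then show "?z k \<in> X" for k
    using scaled_indicator_mem_order_continuous_part[OF u B(2) fin W_fin] by auto
  show "\<rho> (?z k) \<le> ennreal ((1/2) ^ Suc k)" for k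
    using small[of k] u[of k] B(2) by (simp add: \<rho>_indicator)
  show "\<rho> (\<lambda>t. (1 + 1 / Suc k) * ?z k t) > 1" for k
    using large[of k] u[of k] B(2) \<rho>_indicator[of "(1 + 1 / Suc k) * u k" "B k"] by (simp add: mult.assoc)
  show "(\<lambda>k. 1 / real (Suc k)) \<longlonglongrightarrow> 0"
    using LIMSEQ_inverse_real_of_nat by (simp add: inverse_eq_divide)
qed (use B in auto)

end

text \<open>The type is general in order to serve natural and real lengths alike.\<close>

lemma disjoint_consecutive_intervals:
  fixes l :: "nat \<Rightarrow> 'a::linordered_semidom"
  assumes "\<And>k. 0 \<le> l k"
  shows "disjoint_family (\<lambda>k. {(\<Sum>j<k. l j)..<(\<Sum>j<Suc k. l j)})"
proof -
  have mono: "(\<Sum>j<m. l j) \<le> (\<Sum>j<n. l j)" if "m \<le> n" for m n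
    using assms that by (intro sum_mono2) auto
  have "{(\<Sum>j<m. l j)..<(\<Sum>j<Suc m. l j)} \<inter> {(\<Sum>j<n. l j)..<(\<Sum>j<Suc n. l j)} = {}" if "m < n" for m n
    using mono[of "Suc m" n] that by (fastforce simp del: sum.lessThan_Suc)
  then show ?thesis
    unfolding disjoint_family_on_def by (metis Int_commute linorder_neqE_nat)
qed


section \<open>Orlicz--Lorentz sequence spaces\<close>

locale orlicz_lorentz_sequence = orlicz \<phi> for \<phi> +
  fixes w :: "nat \<Rightarrow> real"
  assumes weight: "weight_sequence w"
begin

lemma w_pos: "w i > 0" and w_decreasing: "i \<le> j \<Longrightarrow> w j \<le> w i" and w_not_summable: "\<not> summable w"
  using weight by (auto simp: weight_sequence_def decseq_def)

abbreviation "C \<equiv> count_space (UNIV :: nat set)"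

lemma emeasure_C_cases:
  obtains n where "emeasure C A = of_nat n" | "emeasure C A = top"
  by (cases "finite A") auto

lemma emeasure_initial_segment: "emeasure C {i. of_nat i < emeasure C A} = emeasure C A"
proof (cases rule: emeasure_C_cases[of A])
  case (1 n)
  then have "{i. of_nat i < emeasure C A} = {..<n}" by auto
  with 1 show ?thesis by simp
next
  case 2
  then have "{i. of_nat i < emeasure C A} = UNIV" by (auto simp: of_nat_less_top)
  with 2 show ?thesis by simp
qed

text \<open>Both sets are initial segments of the naturals because \<open>w\<close> decreases, so
  one contains the other and the intersection is the smaller one.\<close>

lemma nested_segments:
  "emeasure C {i \<in> space C. w i > r \<and> of_nat i < emeasure C B} =
    min (emeasure C {i \<in> space C. w i > r}) (emeasure C B)"
proof (cases "{i. of_nat i < emeasure C B} \<subseteq> {i. w i > r}")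
  case True
  then have "{i \<in> space C. w i > r \<and> of_nat i < emeasure C B} = {i. of_nat i < emeasure C B}" by auto
  moreover have "emeasure C {i. of_nat i < emeasure C B} \<le> emeasure C {i. w i > r}"
    using True by (intro emeasure_mono) auto
  ultimately show ?thesis by (simp add: emeasure_initial_segment min_absorb2)
next
  case False
  then obtain j where j: "of_nat j < emeasure C B" "\<not> w j > r" by auto
  have sub: "{i. w i > r} \<subseteq> {i. of_nat i < emeasure C B}"
  proof safe
    fix i assume "w i > r"
    then have "\<not> j \<le> i" using w_decreasing[of j i] j(2) by linarith
    then have "of_nat i < (of_nat j :: ennreal)" by simp
    with j(1) show "of_nat i < emeasure C B" by (rule less_trans[rotated])
  qed
  then have "{i \<in> space C. w i > r \<and> of_nat i < emeasure C B} = {i. w i > r}" by auto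
  moreover have "emeasure C {i. w i > r} \<le> emeasure C {i. of_nat i < emeasure C B}"
    using sub by (intro emeasure_mono) auto
  ultimately show ?thesis by (simp add: emeasure_initial_segment min_absorb1)
qed

sublocale rearranged \<phi> C C of_nat w
  by (intro rearranged.intro rearranged_axioms.intro orlicz_axioms nested_segments
    sigma_finite_measure_count_space) auto

lemma W_of_nat: "W (of_nat n) = ennreal (\<Sum>i<n. w i)"
proof -
  have "W (of_nat n) = (\<integral>\<^sup>+i. ennreal (w i) * indicator {..<n} i \<partial>C)"
    unfolding W_def by (intro nn_integral_cong) (auto simp: indicator_def)
  also have "\<dots> = (\<Sum>i<n. ennreal (w i))"
    by (subst nn_integral_count_space_indicator[symmetric]) (auto simp: nn_integral_count_space_finite)
  also have "\<dots> = ennreal (\<Sum>i<n. w i)" using w_pos by (intro sum_ennreal) (simp add: less_imp_le)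
  finally show ?thesis .
qed

sublocale rearranged_small \<phi> C C of_nat w
proof
  fix \<epsilon> :: real
  \<comment> \<open>Counting measure below 1 forces the empty set, so \<open>\<eta> = 1\<close>
    works for every \<open>\<epsilon>\<close>.\<close>
  have "W (emeasure C B) \<le> ennreal \<epsilon>" if "emeasure C B < ennreal 1" for B
  proof -
    have "emeasure C B = 0"
      using that by (cases rule: emeasure_C_cases[of B]) auto
    then show ?thesis by (simp add: W_zero)
  qed
  then show "\<exists>\<eta>>0. \<forall>B\<in>sets C. emeasure C B < ennreal \<eta> \<longrightarrow> W (emeasure C B) \<le> ennreal \<epsilon>"
    by (intro exI[of _ 1]) auto
qed

lemma seq_rearrangement_eq: "seq_rearrangement x i = rearr x i"
proof -
  \<comment> \<open>The strict bound \<open>i + 1\<close> and the weak bound \<open>i\<close> agree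
    because counting measure takes only natural values and infinity.\<close>
  have "D x s < of_nat (i + 1) \<longleftrightarrow> D x s \<le> of_nat i" for s
    unfolding distribution_function_def
    by (cases rule: emeasure_C_cases[of "{t \<in> space C. \<bar>x t\<bar> > s}"])
      (auto simp: less_Suc_eq_le top_unique simp flip: of_nat_Suc)
  then show ?thesis by (simp add: seq_rearrangement_def rearr_def)
qed

lemma alpha_eq: "alpha \<phi> w = \<rho>"
  by (rule ext) (simp add: alpha_def \<rho>_def seq_rearrangement_eq nn_integral_count_space_nat)

text \<open>The number of terms is maximal subject to the modular staying below
  \<open>(1/2) ^ Suc k\<close>; since the first weight alone contributes at most half of this, the
  modular is at least half of it.\<close>

lemma block_exists:
  assumes "\<not> Delta2_zero \<phi>"
  obtains u and n :: nat where "u > 0" "\<phi> u * (\<Sum>i<n. w i) \<le> (1/2) ^ Suc k"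
    "\<phi> ((1 + 1 / Suc k) * u) * (\<Sum>i<n. w i) > 1"
proof -
  define c :: real where "c = (1/2) ^ Suc (Suc k)"
  have c: "c > 0" "2 * c = (1/2) ^ Suc k" by (auto simp: c_def)
  have \<phi>1: "\<phi> 1 > 0" by (simp add: \<phi>_pos)
  \<comment> \<open>The second bound makes the first term \<open>\<phi> u * w 0\<close> at most
    \<open>c\<close>; the cap 1 permits the linear bound on \<phi>.\<close>
  define u0 where "u0 = min 1 (c / (\<phi> 1 * w 0))"
  have "u0 > 0" using c \<phi>1 w_pos by (auto simp: u0_def)
  \<comment> \<open>The gain \<open>1 / c\<close> lifts a modular above \<open>c\<close> to one
    above 1.\<close>
  then obtain u where u: "0 < u" "u \<le> u0" "\<phi> ((1 + 1 / Suc k) * u) > 1 / c * \<phi> u"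
    using not_Delta2_zero_dilation[OF assms, of "1 / Suc k" "1 / c" u0] c by auto
  have "\<phi> u \<le> u * \<phi> 1" using u by (intro \<phi>_le_linear) (auto simp: u0_def)
  also have "\<dots> \<le> c / (\<phi> 1 * w 0) * \<phi> 1"
    using u \<phi>1 by (intro mult_right_mono) (auto simp: u0_def)
  finally have "\<phi> u \<le> c / w 0" using \<phi>1 by simp
  then have first: "\<phi> u * w 0 \<le> c" using w_pos[of 0] by (simp add: field_simps)
  have \<phi>u: "\<phi> u > 0" using u by (simp add: \<phi>_pos)
  have "\<exists>n. \<phi> u * (\<Sum>i<n. w i) > 2 * c"
  proof (rule ccontr)
    assume "\<not> ?thesis"
    then have "(\<Sum>i<n. w i) \<le> 2 * c / \<phi> u" for n
      using \<phi>u by (auto simp: not_less field_simps)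
    then have "summable w" using w_pos by (intro summableI_nonneg_bounded) (auto simp: less_imp_le)
    with w_not_summable show False by simp
  qed
  from exists_least_iff[THEN iffD1, OF this] obtain m where m: "\<phi> u * (\<Sum>i<m. w i) > 2 * c"
    "\<And>n. n < m \<Longrightarrow> \<phi> u * (\<Sum>i<n. w i) \<le> 2 * c"
    by (auto simp: not_less)
  \<comment> \<open>The least \<open>m\<close> that overshoots \<open>2 * c\<close> is positive, and
    giving up its last term loses at most \<open>c\<close>.\<close>
  obtain n where n: "m = Suc n" using m(1) c by (cases m) auto
  have "\<phi> u * w n \<le> \<phi> u * w 0" using \<phi>u w_decreasing[of 0 n] by simp
  with m(1) first n have "\<phi> u * (\<Sum>i<n. w i) > c" by (simp add: algebra_simps)
  then have "1 < 1 / c * \<phi> u * (\<Sum>i<n. w i)" using c by (simp add: field_simps)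
  also have "\<dots> \<le> \<phi> ((1 + 1 / Suc k) * u) * (\<Sum>i<n. w i)"
    using u(3) w_pos by (intro mult_right_mono sum_nonneg) (auto simp: less_imp_le)
  finally have "\<phi> ((1 + 1 / Suc k) * u) * (\<Sum>i<n. w i) > 1" .
  with that[OF u(1)] m(2)[of n] n c show ?thesis by simp
qed

theorem sequence_diameter_two:
  assumes "\<not> Delta2_zero \<phi>"
    and X: "X = lambda_space \<phi> w \<or> X = lambda_oc \<phi> w"
  shows "SD2P X (lambda_norm \<phi> w) \<and> D2P X (lambda_norm \<phi> w) \<and> LD2P X (lambda_norm \<phi> w)"
proof -
  have "\<exists>u n. u > 0 \<and> \<phi> u * (\<Sum>i<n. w i) \<le> (1/2) ^ Suc k \<and>
      \<phi> ((1 + 1 / Suc k) * u) * (\<Sum>i<n. w i) > 1" for k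
    using block_exists[OF assms(1)] by metis
  then obtain u :: "nat \<Rightarrow> real" and n :: "nat \<Rightarrow> nat" where u: "\<And>k. u k > 0"
    and small: "\<And>k. \<phi> (u k) * (\<Sum>i<n k. w i) \<le> (1/2) ^ Suc k"
    and large: "\<And>k. \<phi> ((1 + 1 / Suc k) * u k) * (\<Sum>i<n k. w i) > 1"
    by metis
  define B where "B k = {(\<Sum>j<k. n j)..<(\<Sum>j<Suc k. n j)}" for k
  have B: "emeasure C (B k) = of_nat (n k)" for k by (simp add: B_def)
  have sum_nonneg: "0 \<le> (\<Sum>i<n. w i)" for n using w_pos by (intro sum_nonneg) (simp add: less_imp_le)
  have prod: "ennreal (\<phi> v) * W (emeasure C (B k)) = ennreal (\<phi> v * (\<Sum>i<n k. w i))" if "v \<ge> 0" for v k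
    unfolding B W_of_nat using that by (intro ennreal_mult[symmetric] \<phi>_nonneg sum_nonneg)
  have "X = \<Lambda> \<or> X = order_continuous_part C \<Lambda> N"
    using X by (simp add: lambda_space_def lambda_oc_def lambda_norm_def alpha_eq)
  moreover have "disjoint_family B"
    unfolding B_def by (rule disjoint_consecutive_intervals) simp
  ultimately have "SD2P X N \<and> D2P X N \<and> LD2P X N"
  proof (intro diameter_two_of_blocks[of u B])
    show "ennreal (\<phi> (u k)) * W (emeasure C (B k)) \<le> ennreal ((1/2) ^ Suc k)" for k
      using u[of k] small[of k] by (subst prod) (auto intro: ennreal_leI)
    show "1 < ennreal (\<phi> ((1 + 1 / Suc k) * u k)) * W (emeasure C (B k))" for k
      using u[of k] large[of k] by (subst prod) auto
  qed (auto simp: u B of_nat_less_top)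
  then show ?thesis by (simp add: lambda_norm_def alpha_eq)
qed

end


section \<open>Orlicz--Lorentz function spaces\<close>

lemma sigma_finite_lebesgue: "sigma_finite_measure (lebesgue :: real measure)"
proof -
  let ?A = "range (\<lambda>n::nat. {- real n..real n})"
  have "x \<in> \<Union>?A" for x
  proof -
    obtain n :: nat where "\<bar>x\<bar> \<le> real n" using real_arch_simple by blast
    then have "x \<in> {- real n..real n}" by auto
    then show ?thesis by blast
  qed
  then have "\<Union>?A = space lebesgue" by auto
  then show ?thesis
    by (intro sigma_finite_measure.intro exI[of _ ?A]) auto
qed

locale orlicz_lorentz_function = orlicz \<phi> for \<phi> +
  fixes \<gamma> :: ereal and w :: "real \<Rightarrow> real"
  assumes \<gamma>_pos: "0 < \<gamma>" and weight: "weight_function \<gamma> w"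
begin

abbreviation "I \<equiv> interval_to \<gamma>"
abbreviation "L \<equiv> lebesgue_on I"

lemma I_down: "t \<in> I \<Longrightarrow> 0 \<le> s \<Longrightarrow> s \<le> t \<Longrightarrow> s \<in> I"
  by (auto simp: interval_to_def intro: le_less_trans[of "ereal s" "ereal t"])

lemma I_nonneg: "t \<in> I \<Longrightarrow> 0 \<le> t"
  by (simp add: interval_to_def)

lemma zero_mem_I: "0 \<in> I"
  using \<gamma>_pos by (simp add: interval_to_def zero_ereal_def)

lemma pos_mem_I: obtains t where "t > 0" "t \<in> I"
proof -
  obtain z where z: "0 < z" "z < \<gamma>" using dense[OF \<gamma>_pos] by blast
  then obtain t where "z = ereal t" by (cases z) auto
  with z that[of t] show ?thesis by (simp add: interval_to_def)
qed

lemma I_cases: obtains "I = {0..}" "\<gamma> = \<infinity>" | c where "c > 0" "I = {0..<c}" "\<gamma> = ereal c"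
proof (cases \<gamma>)
  case (real c)
  with \<gamma>_pos show ?thesis by (intro that(2)[of c]) (auto simp: interval_to_def)
qed (use \<gamma>_pos that(1) in \<open>auto simp: interval_to_def\<close>)

lemma I_sets [measurable]: "I \<in> sets lebesgue" "I \<in> sets borel"
  by (cases rule: I_cases; simp)+

lemma space_L [simp]: "space L = I"
  by simp

lemma w_pos: "t \<in> I \<Longrightarrow> t \<noteq> 0 \<Longrightarrow> w t > 0"
  using weight by (simp add: weight_function_def)

lemma w_antimono: "t \<in> I \<Longrightarrow> 0 < s \<Longrightarrow> s \<le> t \<Longrightarrow> w t \<le> w s"
  using weight I_down[of t s] by (auto simp: weight_function_def monotone_on_def)

text \<open>\<open>w\<close> is monotone only off the origin, where its value is unconstrained; the
  function off the origin and the value at the origin are glued together.\<close>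

lemma w_measurable: "w \<in> borel_measurable L"
proof -
  have "mono_on (I - {0}) (\<lambda>t. - w t)"
    using weight by (auto simp: weight_function_def monotone_on_def)
  then have "(\<lambda>t. - w t) \<in> borel_measurable (restrict_space borel (I - {0}))"
    by (rule borel_measurable_mono_on_fnc)
  then have off_origin: "(\<lambda>t. indicator (I - {0}) t *\<^sub>R - w t) \<in> borel_measurable borel"
    by (subst (asm) borel_measurable_restrict_space_iff) auto
  have "(\<lambda>t. - (indicator (I - {0}) t *\<^sub>R - w t) + w 0 * indicator {0} t) \<in> borel_measurable borel"
    by (intro borel_measurable_add borel_measurable_uminus[OF off_origin] borel_measurable_times
      borel_measurable_const borel_measurable_indicator) auto
  then have "(\<lambda>t. - (indicator (I - {0}) t *\<^sub>R - w t) + w 0 * indicator {0} t) \<in> borel_measurable L"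
    by (intro measurable_restrict_space1 measurable_completion) simp
  then show ?thesis
    by (rule measurable_cong[THEN iffD1, rotated]) (auto simp: indicator_def)
qed

lemma ennreal_measurable: "ennreal \<in> borel_measurable L"
  by (intro measurable_restrict_space1 measurable_completion) simp

lemma emeasure_L: "A \<in> sets lebesgue \<Longrightarrow> A \<subseteq> I \<Longrightarrow> emeasure L A = emeasure lebesgue A"
  by (rule emeasure_restrict_space) auto

lemma emeasure_initial_segment:
  assumes "x \<le> emeasure L I"
  shows "emeasure L {t \<in> I. ennreal t < x} = x"
proof (cases x)
  case (real r)
  have "{t \<in> I. ennreal t < x} = {0..<r}"
  proof (cases rule: I_cases)
    case 1
    show ?thesis unfolding 1(1) real(1) using real(2) by (auto simp: ennreal_less_iff)
  next
    case (2 c)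
    have "emeasure L I = emeasure lebesgue I" by (rule emeasure_L) auto
    also have "\<dots> = ennreal c" unfolding 2(2) using 2(1) by simp
    finally have "r \<le> c" using assms real 2(1) by simp
    then show ?thesis unfolding 2(2) real(1) using real(2) by (auto simp: ennreal_less_iff)
  qed
  moreover have "{t \<in> I. ennreal t < x} \<subseteq> I" by auto
  ultimately show ?thesis using real by (simp add: emeasure_L)
next
  case top
  then have "{t \<in> I. ennreal t < x} = I" by auto
  with assms top show ?thesis by (simp add: top_unique)
qed

lemma null_origin: "emeasure L {0} = 0"
  using zero_mem_I by (subst emeasure_L) auto

text \<open>The same alternative as for sequences. Two values of \<open>w\<close> can be compared
  only at positive positions, so the inclusions hold up to the null set \<open>{0}\<close>.\<close>

lemma nested_segments:
  assumes B: "B \<in> sets L"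
  shows "emeasure L {t \<in> space L. w t > r \<and> ennreal t < emeasure L B} =
    min (emeasure L {t \<in> space L. w t > r}) (emeasure L B)"
proof -
  let ?P = "{t \<in> I. w t > r}" and ?Q = "{t \<in> I. ennreal t < emeasure L B}"
  have "{t \<in> space L. w t > r} \<in> sets L" "{t \<in> space L. ennreal t < emeasure L B} \<in> sets L"
    using w_measurable ennreal_measurable by measurable
  then have P [simp]: "?P \<in> sets L" and Q [simp]: "?Q \<in> sets L"
    by (simp_all only: space_L)
  have zero: "{0} \<in> sets L" using zero_mem_I by (simp add: sets_restrict_space_iff)
  have "emeasure L B \<le> emeasure L I"
    using sets.sets_into_space[OF B] sets.top[of L] by (intro emeasure_mono) (simp_all only: space_L)
  then have eQ: "emeasure L ?Q = emeasure L B" by (rule emeasure_initial_segment)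
  have up_to_origin: "emeasure L X \<le> emeasure L Y" if "X \<subseteq> insert 0 Y" "Y \<in> sets L" for X Y
  proof -
    have "emeasure L X \<le> emeasure L (Y \<union> {0})"
      using that zero by (intro emeasure_mono sets.Un) auto
    also have "\<dots> = emeasure L Y"
      using that null_origin zero by (intro emeasure_Un_null_set) (simp_all add: null_sets_def)
    finally show ?thesis .
  qed
  have eq: "emeasure L (?P \<inter> ?Q) = min (emeasure L ?P) (emeasure L ?Q)"
  proof (cases "?Q \<subseteq> insert 0 ?P")
    case True
    have "emeasure L ?Q \<le> emeasure L (?P \<inter> ?Q)" using True by (intro up_to_origin sets.Int P Q) auto
    moreover have "emeasure L ?Q \<le> emeasure L ?P" using True by (intro up_to_origin P)
    moreover have "emeasure L (?P \<inter> ?Q) \<le> emeasure L ?Q" by (intro emeasure_mono Int_lower2 Q)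
    ultimately show ?thesis by (simp add: min_absorb2)
  next
    case False
    then obtain j where j: "j \<in> I" "j \<noteq> 0" "ennreal j < emeasure L B" "\<not> w j > r" by auto
    have "?P \<subseteq> insert 0 ?Q"
    proof
      fix t assume t: "t \<in> ?P"
      show "t \<in> insert 0 ?Q"
      proof (cases "t = 0")
        case False
        have "\<not> j \<le> t" using w_antimono[of t j] I_nonneg[OF j(1)] j(2,4) t by fastforce
        then have "ennreal t \<le> ennreal j" by (intro ennreal_leI) auto
        with j(3) t show ?thesis by auto
      qed simp
    qed
    then have "?P \<subseteq> insert 0 (?P \<inter> ?Q)" "?P \<subseteq> insert 0 ?Q" by auto
    then have "emeasure L ?P \<le> emeasure L (?P \<inter> ?Q)" "emeasure L ?P \<le> emeasure L ?Q"
      by (auto intro!: up_to_origin sets.Int P Q)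
    moreover have "emeasure L (?P \<inter> ?Q) \<le> emeasure L ?P" by (intro emeasure_mono Int_lower1 P)
    ultimately show ?thesis by (simp add: min_absorb1)
  qed
  have "?P \<inter> ?Q = {t \<in> space L. w t > r \<and> ennreal t < emeasure L B}" by auto
  with eq eQ show ?thesis by simp
qed

sublocale rearranged \<phi> L L ennreal w
  by (intro rearranged.intro rearranged_axioms.intro orlicz_axioms nested_segments w_measurable
    ennreal_measurable sigma_finite_measure_restrict_space sigma_finite_lebesgue) auto

definition V :: "real \<Rightarrow> real" where
  "V t = integral {0..t} w"

lemma w_integrable: "t \<in> I \<Longrightarrow> w integrable_on {0..t}"
  using weight by (auto simp: weight_function_def intro: set_lebesgue_integral_eq_integral)

lemma W_eq:
  assumes t: "t \<in> I"
  shows "W (ennreal t) = ennreal (V t)"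
proof -
  have "W (ennreal t) = (\<integral>\<^sup>+x. indicator {x. ennreal x < ennreal t} x * ennreal (w x) * indicator I x \<partial>lebesgue)"
    unfolding W_def by (subst nn_integral_restrict_space) (auto simp: ac_simps)
  \<comment> \<open>The origin, a null set, is dropped because nothing is known about the sign of
    \<open>w 0\<close>.\<close>
  also have "\<dots> = (\<integral>\<^sup>+x. ennreal (w x) * indicator {0<..<t} x \<partial>lebesgue)"
  proof (rule nn_integral_cong_AE)
    have "AE x in lebesgue. x \<noteq> (0::real)" by (rule AE_completion) (rule AE_lborel_singleton)
    then show "AE x in lebesgue. indicator {x. ennreal x < ennreal t} x * ennreal (w x) * indicator I x =
        ennreal (w x) * indicator {0<..<t} x"
    proof (rule eventually_mono)
      fix x :: real assume "x \<noteq> 0"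
      then have "x \<in> I \<and> ennreal x < ennreal t \<longleftrightarrow> 0 < x \<and> x < t"
        using I_nonneg[of x] I_down[OF t, of x] by (auto simp: ennreal_less_iff)
      then show "indicator {x. ennreal x < ennreal t} x * ennreal (w x) * indicator I x =
        ennreal (w x) * indicator {0<..<t} x" by (auto simp: indicator_def)
    qed
  qed
  also have "\<dots> = (\<integral>\<^sup>+x. ennreal (w x) * indicator {0<..<t} x \<partial>lborel)"
    by (rule nn_integral_completion)
  also have "\<dots> = ennreal (V t)"
  proof (rule nn_integral_has_integral_lebesgue')
    show "0 \<le> w x" if "x \<in> {0<..<t}" for x
      using w_pos[of x] I_down[OF t, of x] that by (auto simp: less_imp_le)
    have "(w has_integral V t) {0..t}"
      unfolding V_def using w_integrable[OF t] by (rule integrable_integral)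
    then show "(w has_integral V t) {0<..<t}" by (simp add: has_integral_Icc_iff_Ioo)
  qed
  finally show ?thesis .
qed

lemma continuous_on_V: "t \<in> I \<Longrightarrow> continuous_on {0..t} V"
  unfolding V_def by (intro indefinite_integral_continuous_1 w_integrable)

lemma V_zero [simp]: "V 0 = 0"
  by (simp add: V_def)

lemma V_nonneg:
  assumes "t \<in> I"
  shows "0 \<le> V t"
proof -
  have "(w has_integral V t) {0<..<t}"
    using integrable_integral[OF w_integrable[OF assms]] by (simp add: V_def has_integral_Icc_iff_Ioo)
  then show ?thesis
    by (rule has_integral_nonneg) (use w_pos I_down[OF assms] in \<open>auto simp: less_imp_le\<close>)
qed

text \<open>A decreasing weight gives \<open>V t \<ge> t * w t\<close>.\<close>

lemma V_pos:
  assumes t: "t \<in> I" "t > 0"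
  shows "V t > 0"
proof -
  have "((\<lambda>x. w t) has_integral t * w t) {0<..<t}"
    using has_integral_const_real[of "w t" 0 t] t by (simp add: has_integral_Icc_iff_Ioo)
  moreover have "(w has_integral V t) {0<..<t}"
    using integrable_integral[OF w_integrable[OF t(1)]] by (simp add: V_def has_integral_Icc_iff_Ioo)
  ultimately have "t * w t \<le> V t"
    by (rule has_integral_le) (use w_antimono[OF t(1)] in auto)
  with t w_pos[of t] show ?thesis by (smt (verit) mult_pos_pos)
qed

sublocale rearranged_small \<phi> L L ennreal w
proof
  fix \<epsilon> :: real assume \<epsilon>: "\<epsilon> > 0"
  obtain t where t: "t > 0" "t \<in> I" by (rule pos_mem_I)
  \<comment> \<open>Either \<open>V t\<close> is small enough already, or continuity and
    \<open>V 0 = 0\<close> supply a length with \<open>V \<eta> = \<epsilon>\<close>.\<close>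
  have "\<exists>\<eta>>0. \<eta> \<in> I \<and> V \<eta> \<le> \<epsilon>"
  proof (cases "V t \<le> \<epsilon>")
    case False
    then obtain \<eta> where \<eta>: "0 \<le> \<eta>" "\<eta> \<le> t" "V \<eta> = \<epsilon>"
      using IVT'[of V 0 \<epsilon> t] continuous_on_V[OF t(2)] t \<epsilon> by auto
    with \<epsilon> have "\<eta> \<noteq> 0" by auto
    with \<eta> I_down[OF t(2), of \<eta>] show ?thesis by (intro exI[of _ \<eta>]) auto
  qed (use t in blast)
  then obtain \<eta> where \<eta>: "\<eta> > 0" "\<eta> \<in> I" "V \<eta> \<le> \<epsilon>" by blast
  have "W (emeasure L B) \<le> ennreal \<epsilon>" if "emeasure L B < ennreal \<eta>" for B
  proof -
    have "W (emeasure L B) \<le> W (ennreal \<eta>)" using that by (intro W_mono) auto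
    also have "\<dots> \<le> ennreal \<epsilon>" using \<eta> by (simp add: W_eq ennreal_leI)
    finally show ?thesis .
  qed
  with \<eta>(1) show "\<exists>\<eta>>0. \<forall>B\<in>sets L. emeasure L B < ennreal \<eta> \<longrightarrow> W (emeasure L B) \<le> ennreal \<epsilon>"
    by blast
qed

text \<open>Monotone convergence over the segments up to \<open>n\<close> transfers the divergence
  of the total weight to \<open>V\<close>. Blocks of small height need such lengths to reach a
  prescribed modular.\<close>

lemma V_unbounded:
  assumes \<gamma>: "\<gamma> = \<infinity>"
  obtains t where "t \<in> I" "V t \<ge> c"
proof -
  have I: "I = {0..}" using \<gamma> by (auto simp: interval_to_def)
  have "\<exists>n::nat. V (real n) > c"
  proof (rule ccontr)
    assume neg: "\<not> ?thesis"
    have "(\<integral>\<^sup>+x. ennreal (w x) * indicator {0..} x \<partial>lebesgue) =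
        (\<integral>\<^sup>+x. (SUP n::nat. indicator {x. ennreal x < ennreal (real n)} x * ennreal (w x)) \<partial>L)"
    proof (subst nn_integral_restrict_space)
      show "(\<integral>\<^sup>+x. ennreal (w x) * indicator {0..} x \<partial>lebesgue) =
        (\<integral>\<^sup>+x. (SUP n::nat. indicator {x. ennreal x < ennreal (real n)} x * ennreal (w x)) * indicator I x \<partial>lebesgue)"
      proof (intro nn_integral_cong)
        fix x :: real
        obtain n :: nat where "\<bar>x\<bar> < real n" using reals_Archimedean2 by blast
        then have "(SUP n::nat. indicator {x. ennreal x < ennreal (real n)} x * ennreal (w x)) = ennreal (w x)" if "x \<ge> 0"
          using that by (intro antisym SUP_least SUP_upper2[of n]) (auto simp: indicator_def ennreal_less_iff)
        then show "ennreal (w x) * indicator {0..} x =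
          (SUP n::nat. indicator {x. ennreal x < ennreal (real n)} x * ennreal (w x)) * indicator I x"
          by (auto simp: I indicator_def)
      qed
    qed auto
    also have "\<dots> = (SUP n::nat. W (ennreal (real n)))"
      unfolding W_def
    proof (rule nn_integral_monotone_convergence_SUP)
      show "incseq (\<lambda>(n::nat) x. indicator {x. ennreal x < ennreal (real n)} x * ennreal (w x))"
        by (auto simp: incseq_def le_fun_def indicator_def intro: less_le_trans ennreal_leI)
    qed (use w_measurable in measurable)
    also have "\<dots> \<le> ennreal c"
    proof (rule SUP_least)
      fix n :: nat
      have "real n \<in> I" using I by simp
      with neg show "W (ennreal (real n)) \<le> ennreal c" by (simp add: W_eq not_less ennreal_leI)
    qed
    finally have "(\<integral>\<^sup>+x\<in>{0..}. ennreal (w x) \<partial>lebesgue) \<le> ennreal c" .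
    moreover have "(\<integral>\<^sup>+x\<in>{0..}. ennreal (w x) \<partial>lebesgue) = \<infinity>"
      using weight \<gamma> by (simp add: weight_function_def)
    ultimately show False by (simp add: top_unique)
  qed
  then obtain n :: nat where "V (real n) > c" ..
  with that[of "real n"] I show ?thesis by auto
qed

text \<open>Continuity of \<open>V\<close> allows a prescribed modular to be met exactly, whereas
  partial sums of a weight sequence jump.\<close>

lemma exact_modular_length:
  assumes "u > 0" "l \<in> I" "c > 0" "\<phi> u * V l \<ge> c"
  obtains t where "0 \<le> t" "t \<le> l" "\<phi> u * V t = c"
proof -
  have "\<exists>t\<ge>0. t \<le> l \<and> \<phi> u * V t = c"
    using assms I_nonneg[OF assms(2)] continuous_on_V[OF assms(2)]
    by (intro IVT' continuous_intros) auto
  with that show ?thesis by blast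
qed

text \<open>\<open>t\<close> is a length, not a position: an interval of length \<open>t\<close>
  anywhere in \<open>I\<close> rearranges to \<open>[0, t)\<close>, so its indicator scaled by
  \<open>u\<close> has modular \<open>\<phi> u * V t\<close>.\<close>

definition block :: "nat \<Rightarrow> real \<Rightarrow> real \<Rightarrow> bool" where
  "block k u t \<longleftrightarrow> u > 0 \<and> t \<ge> 0 \<and> t \<in> I \<and> \<phi> u * V t = (1/2) ^ Suc k \<and> \<phi> ((1 + 1 / Suc k) * u) * V t > 1"

text \<open>The gain \<open>2 * 2 ^ Suc k\<close> times the modular \<open>(1/2) ^ Suc k\<close> is
  2, which leaves room for the strict inequality.\<close>

lemma blockI:
  assumes u: "u > 0" "\<phi> ((1 + 1 / Suc k) * u) > 2 * 2 ^ Suc k * \<phi> u"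
    and t: "t \<ge> 0" "t \<in> I" "\<phi> u * V t = (1/2) ^ Suc k"
  shows "block k u t"
proof -
  have "1 < 2 * 2 ^ Suc k * (1/2 :: real) ^ Suc k" by (simp add: power_one_over)
  also have "\<dots> = 2 * 2 ^ Suc k * \<phi> u * V t" by (simp only: mult.assoc t(3))
  also have "\<dots> \<le> \<phi> ((1 + 1 / Suc k) * u) * V t"
    using u V_nonneg[OF t(2)] by (intro mult_right_mono) auto
  finally show ?thesis using u t by (simp add: block_def)
qed

lemma block_exists_infinity:
  assumes "\<not> Delta2_infinity \<phi>" and l: "l \<in> I" "l > 0"
  obtains u t where "block k u t" "t \<le> l"
proof -
  have Vl: "V l > 0" using l by (rule V_pos)
  have \<phi>1: "\<phi> 1 > 0" by (simp add: \<phi>_pos)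
  \<comment> \<open>From this height on, \<open>\<phi> u * V l \<ge> 1\<close>, so the prescribed
    modular is reached within the length \<open>l\<close>: great height makes short blocks.\<close>
  define u0 where "u0 = 1 + 1 / (\<phi> 1 * V l)"
  have u0: "u0 \<ge> 1" using Vl \<phi>1 by (simp add: u0_def)
  obtain u where u: "u \<ge> u0" "\<phi> ((1 + 1 / Suc k) * u) > 2 * 2 ^ Suc k * \<phi> u"
    using not_Delta2_infinity_dilation[OF assms(1), of "1 / Suc k" "2 * 2 ^ Suc k" u0] u0 by auto
  have "(1/2::real) ^ Suc k \<le> 1" by (rule power_le_one) auto
  also have "1 \<le> u0 * \<phi> 1 * V l" using \<phi>1 Vl by (simp add: u0_def field_simps)
  also have "\<dots> \<le> u * \<phi> 1 * V l" using u \<phi>1 Vl by (intro mult_right_mono) auto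
  also have "\<dots> \<le> \<phi> u * V l" using \<phi>_ge_linear[of u] u u0 Vl by (intro mult_right_mono) auto
  finally obtain t where "0 \<le> t" "t \<le> l" "\<phi> u * V t = (1/2) ^ Suc k"
    using u u0 l by (elim exact_modular_length[rotated 3]) auto
  with u u0 l that show ?thesis by (intro that[of u t] blockI I_down[of l t]) auto
qed

text \<open>The length of a block of small height is not controlled, which does no harm on the
  infinite interval; any bound on \<open>u\<close>, here 1, will do.\<close>

lemma block_exists_zero:
  assumes "\<not> Delta2_zero \<phi>" "\<gamma> = \<infinity>"
  obtains u t where "block k u t"
proof -
  obtain u where u: "u > 0" "\<phi> ((1 + 1 / Suc k) * u) > 2 * 2 ^ Suc k * \<phi> u"
    using not_Delta2_zero_dilation[OF assms(1), of "1 / Suc k" "2 * 2 ^ Suc k" 1] by auto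
  have \<phi>u: "\<phi> u > 0" using u by (simp add: \<phi>_pos)
  obtain l where l: "l \<in> I" "V l \<ge> (1/2) ^ Suc k / \<phi> u" by (rule V_unbounded[OF assms(2)])
  then have "\<phi> u * V l \<ge> (1/2) ^ Suc k" using \<phi>u by (simp add: field_simps)
  then obtain t where "0 \<le> t" "t \<le> l" "\<phi> u * V t = (1/2) ^ Suc k"
    using u l by (elim exact_modular_length[rotated 3]) auto
  with u l show ?thesis by (intro that[of u t] blockI I_down[of l t]) auto
qed

text \<open>The split is on the condition at infinity, not on \<open>\<gamma>\<close>. If it fails,
  blocks can be made short and fit into any interval; if it holds, the hypothesis forces
  \<open>\<gamma> = \<infinity>\<close> and failure near 0, and the total length is
  unrestricted.\<close>

lemma blocks_exist:
  assumes "if \<gamma> < \<infinity> then \<not> Delta2_infinity \<phi> else \<not> Delta2 \<phi>"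
  obtains u t where "\<And>k. block k (u k) (t k)" "\<And>k. (\<Sum>j<k. t j) \<in> I"
proof (cases "Delta2_infinity \<phi>")
  case True
  with assms have \<gamma>: "\<gamma> = \<infinity>" and "\<not> Delta2_zero \<phi>" by (auto simp: Delta2_def split: if_splits)
  then have "\<exists>u t. block k u t" for k using block_exists_zero by metis
  then obtain u t where ut: "\<And>k. block k (u k) (t k)" by metis
  then have "0 \<le> (\<Sum>j<k. t j)" for k by (intro sum_nonneg) (auto simp: block_def)
  with \<gamma> ut that show ?thesis by (auto simp: interval_to_def)
next
  case False
  obtain l where l: "l > 0" "l \<in> I" by (rule pos_mem_I)
  \<comment> \<open>The allowed lengths form a geometric series with sum \<open>l\<close>, so all
    blocks fit side by side.\<close>
  have "\<exists>u t. block k u t \<and> t \<le> l * (1/2) ^ Suc k" for k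
  proof -
    have "(1/2::real) ^ Suc k \<le> 1" by (rule power_le_one) auto
    then have "l * (1/2) ^ Suc k \<le> l" using l by (intro mult_left_le) auto
    then have "l * (1/2) ^ Suc k \<in> I" using l by (intro I_down[OF l(2)]) auto
    then show ?thesis using block_exists_infinity[OF False, of "l * (1/2) ^ Suc k" k] l by (metis half_gt_zero_iff mult_pos_pos zero_less_one zero_less_power)
  qed
  then obtain u t where ut: "\<And>k. block k (u k) (t k)" "\<And>k. t k \<le> l * (1/2) ^ Suc k" by metis
  have "(\<Sum>j<k. t j) \<in> I" for k
  proof (rule I_down[OF l(2)])
    show "0 \<le> (\<Sum>j<k. t j)" using ut(1) by (intro sum_nonneg) (auto simp: block_def)
    have "(\<Sum>j<k. t j) \<le> l * (1 - (1/2) ^ k)"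
    proof (induction k)
      case (Suc k)
      with ut(2)[of k] show ?case by (simp add: algebra_simps)
    qed simp
    also have "\<dots> \<le> l" using l by (intro mult_left_le) auto
    finally show "(\<Sum>j<k. t j) \<le> l" .
  qed
  with ut(1) that show ?thesis by blast
qed

lemma rho_eq: "rho \<gamma> \<phi> w = \<rho>"
  by (rule ext) (simp add: rho_def \<rho>_def rearrangement_def rearr_def)

theorem function_diameter_two:
  assumes "if \<gamma> < \<infinity> then \<not> Delta2_infinity \<phi> else \<not> Delta2 \<phi>"
    and X: "X = Lambda_space \<gamma> \<phi> w \<or> X = Lambda_oc \<gamma> \<phi> w"
  shows "SD2P X (Lambda_norm \<gamma> \<phi> w) \<and> D2P X (Lambda_norm \<gamma> \<phi> w) \<and> LD2P X (Lambda_norm \<gamma> \<phi> w)"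
proof -
  obtain u t where block: "\<And>k. block k (u k) (t k)" and sums: "\<And>k. (\<Sum>j<k. t j) \<in> I"
    using blocks_exist[OF assms(1)] by blast
  have u: "u k > 0" and t: "t k \<ge> 0" "t k \<in> I" and small: "\<phi> (u k) * V (t k) = (1/2) ^ Suc k"
    and large: "\<phi> ((1 + 1 / Suc k) * u k) * V (t k) > 1" for k
    using block[of k] by (auto simp: block_def)
  define B where "B k = {(\<Sum>j<k. t j)..<(\<Sum>j<Suc k. t j)}" for k
  have B_sub: "B k \<subseteq> I" for k
    using I_nonneg[OF sums[of k]] I_down[OF sums[of "Suc k"]] by (auto simp: B_def simp del: sum.lessThan_Suc)
  have B_sets: "B k \<in> sets L" for k using B_sub by (auto simp: sets_restrict_space_iff) (simp add: B_def)
  have B: "emeasure L (B k) = ennreal (t k)" for k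
    using t(1)[of k] B_sub by (subst emeasure_L) (auto simp: B_def)
  have prod: "ennreal (\<phi> v) * W (emeasure L (B k)) = ennreal (\<phi> v * V (t k))" if "v \<ge> 0" for v k
    unfolding B W_eq[OF t(2)] using that by (intro ennreal_mult[symmetric] \<phi>_nonneg V_nonneg t)
  have "X = \<Lambda> \<or> X = order_continuous_part L \<Lambda> N"
    using X by (simp add: Lambda_space_def Lambda_oc_def Lambda_norm_def rho_eq)
  moreover have "disjoint_family B"
    unfolding B_def by (rule disjoint_consecutive_intervals) (rule t)
  ultimately have "SD2P X N \<and> D2P X N \<and> LD2P X N"
  proof (intro diameter_two_of_blocks[of u B])
    show "ennreal (\<phi> (u k)) * W (emeasure L (B k)) \<le> ennreal ((1/2) ^ Suc k)" for k
      using u[of k] small[of k] by (subst prod) auto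
    show "1 < ennreal (\<phi> ((1 + 1 / Suc k) * u k)) * W (emeasure L (B k))" for k
      using u[of k] large[of k] by (subst prod) auto
  qed (use u B B_sets in auto)
  then show ?thesis by (simp add: Lambda_norm_def rho_eq)
qed

end

theorem theorem3p13:
  shows "(\<forall>(\<gamma>::ereal) (\<phi>::real \<Rightarrow> real) (w::real \<Rightarrow> real).
            0 < \<gamma> \<and> orlicz_function \<phi> \<and> nondegenerate \<phi> \<and> weight_function \<gamma> w \<and>
            (if \<gamma> < \<infinity> then \<not> Delta2_infinity \<phi> else \<not> Delta2 \<phi>)
            \<longrightarrow>
            (SD2P (Lambda_oc \<gamma> \<phi> w) (Lambda_norm \<gamma> \<phi> w) \<and>
             SD2P (Lambda_space \<gamma> \<phi> w) (Lambda_norm \<gamma> \<phi> w)) \<and>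
            (D2P (Lambda_oc \<gamma> \<phi> w) (Lambda_norm \<gamma> \<phi> w) \<and>
             D2P (Lambda_space \<gamma> \<phi> w) (Lambda_norm \<gamma> \<phi> w)) \<and>
            (LD2P (Lambda_oc \<gamma> \<phi> w) (Lambda_norm \<gamma> \<phi> w) \<and>
             LD2P (Lambda_space \<gamma> \<phi> w) (Lambda_norm \<gamma> \<phi> w)))
       \<and>
         (\<forall>(\<phi>::real \<Rightarrow> real) (w::nat \<Rightarrow> real).
            orlicz_function \<phi> \<and> nondegenerate \<phi> \<and> weight_sequence w \<and> \<not> Delta2_zero \<phi>
            \<longrightarrow>
            (SD2P (lambda_oc \<phi> w) (lambda_norm \<phi> w) \<and>
             SD2P (lambda_space \<phi> w) (lambda_norm \<phi> w)) \<and>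
            (D2P (lambda_oc \<phi> w) (lambda_norm \<phi> w) \<and>
             D2P (lambda_space \<phi> w) (lambda_norm \<phi> w)) \<and>
            (LD2P (lambda_oc \<phi> w) (lambda_norm \<phi> w) \<and>
             LD2P (lambda_space \<phi> w) (lambda_norm \<phi> w)))"
proof (rule conjI; intro allI impI; elim conjE)
  fix \<gamma> :: ereal and \<phi> w :: "real \<Rightarrow> real"
  assume "0 < \<gamma>" "orlicz_function \<phi>" "nondegenerate \<phi>" "weight_function \<gamma> w"
    and \<Delta>: "if \<gamma> < \<infinity> then \<not> Delta2_infinity \<phi> else \<not> Delta2 \<phi>"
  then interpret orlicz_lorentz_function \<phi> \<gamma> w by unfold_locales
  show "(SD2P (Lambda_oc \<gamma> \<phi> w) (Lambda_norm \<gamma> \<phi> w) \<and>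
         SD2P (Lambda_space \<gamma> \<phi> w) (Lambda_norm \<gamma> \<phi> w)) \<and>
        (D2P (Lambda_oc \<gamma> \<phi> w) (Lambda_norm \<gamma> \<phi> w) \<and>
         D2P (Lambda_space \<gamma> \<phi> w) (Lambda_norm \<gamma> \<phi> w)) \<and>
        (LD2P (Lambda_oc \<gamma> \<phi> w) (Lambda_norm \<gamma> \<phi> w) \<and>
         LD2P (Lambda_space \<gamma> \<phi> w) (Lambda_norm \<gamma> \<phi> w))"
    using function_diameter_two[OF \<Delta>] by blast
next
  fix \<phi> :: "real \<Rightarrow> real" and w :: "nat \<Rightarrow> real"
  assume "orlicz_function \<phi>" "nondegenerate \<phi>" "weight_sequence w" and \<Delta>: "\<not> Delta2_zero \<phi>"
  then interpret orlicz_lorentz_sequence \<phi> w by unfold_locales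
  show "(SD2P (lambda_oc \<phi> w) (lambda_norm \<phi> w) \<and> SD2P (lambda_space \<phi> w) (lambda_norm \<phi> w)) \<and>
        (D2P (lambda_oc \<phi> w) (lambda_norm \<phi> w) \<and> D2P (lambda_space \<phi> w) (lambda_norm \<phi> w)) \<and>
        (LD2P (lambda_oc \<phi> w) (lambda_norm \<phi> w) \<and> LD2P (lambda_space \<phi> w) (lambda_norm \<phi> w))"
    using sequence_diameter_two[OF \<Delta>] by blast
qed

end
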